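(* Let $p \geq 2$ be an integer, let $\Omega$ be an open subset of $\mathbb{R}^d$, and let $f:\Omega \to \mathbb{R}$ be a non-negative function of class $C^p$ with zero set $\mathcal{Z} = \{x \in \Omega : f(x) = 0\}$. Assume that $f$ satisfies the global normal Hessian condition, i.e. $f$ satisfies the normal Hessian condition at every point $x_0 \in \mathcal{Z}$. Then there exists an at most countable index set $I$ and a family $(f_i)_{i \in I}$ of functions $f_i \in C^{p-2}(\Omega)$ with locally finite support such that \[ \forall x \in \Omega,\quad f(x) = \sum_{i \in I} f_i(x)^2. \] Moreover: (1) if $f$ satisfies the strict Hessian condition, i.e. $\nabla^2 f(x_0)$ is positive definite for every $x_0 \in \mathcal{Z}$, then $\mathcal{Z}$ is discrete and such a decomposition can be found with $|I| \leq d+1$; (2) if $\mathcal{Z}$ is compact, then $I$ can be taken to be finite.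
   Context: A subset $N \subset \mathbb{R}^d$ is a sub-manifold of $\mathbb{R}^d$ of class $C^k$ ($k \geq 1$) if for every $x \in N$ there is an integer $d_x$, an open neighborhood $U$ of $0$ in $\mathbb{R}^{d_x}$, an open set $V \subset \mathbb{R}^d$ and a $C^k$ map $\phi: U \to \mathbb{R}^d$ with $\phi(0)=x$, $\phi(U) = N \cap V$, $\phi: U \to \phi(U)$ a homeomorphism, and $d\phi(0)$ injective; $d_x$ is the dimension of $N$ at $x$ and $T_xN = d\phi(0)(\mathbb{R}^{d_x})$ is the tangent space. A non-negative $C^p$ function $f$ ($p\ge 2$) defined on an open neighborhood of $x_0 \in \mathbb{R}^d$ with $f(x_0)=0$ satisfies the normal Hessian condition (NHC) at $x_0$ if there exist $0 \leq d_0 \leq d$ and a sub-manifold $N$ of $\mathbb{R}^d$ of class $C^k$ for some $k \geq 1$ and of dimension $d_0$ with $x_0 \in N \subset \mathcal{Z}$ (the zero set of $f$), such that the rank of the Hessian matrix $\nabla^2 f(x_0)$ equals $d - d_0$ (equivalently, the restriction of $d^2 f(x_0)$ to the orthogonal complement $(T_{x_0}N)^{\perp}$ is positive definite). A family $(f_i)_{i\in I}$ of functions on a topological space $X$ has locally finite support if every $x \in X$ has an open neighborhood meeting only finitely many of the sets $\mathrm{supp}(f_i) = \overline{\{y : f_i(y) \neq 0\}}$. *)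

theory Defs
  imports "HOL-Analysis.Analysis"
begin

fun Ck_on :: "nat \<Rightarrow> 'a::euclidean_space set \<Rightarrow> ('a \<Rightarrow> real) \<Rightarrow> bool" where
  "Ck_on 0 S g = continuous_on S g"
| "Ck_on (Suc k) S g =
     ((\<forall>x\<in>S. g differentiable (at x)) \<and>
      (\<forall>b\<in>Basis. Ck_on k S (\<lambda>x. frechet_derivative g (at x) b)))"

definition Ck_vec_on :: "nat \<Rightarrow> 'a::euclidean_space set \<Rightarrow> ('a \<Rightarrow> 'b::euclidean_space) \<Rightarrow> bool" where
  "Ck_vec_on k S g \<longleftrightarrow> (\<forall>c\<in>Basis. Ck_on k S (\<lambda>x. g x \<bullet> c))"

definition second_deriv :: "('a::euclidean_space \<Rightarrow> real) \<Rightarrow> 'a \<Rightarrow> 'a \<Rightarrow> 'a \<Rightarrow> real" where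
  "second_deriv g x u v = frechet_derivative (\<lambda>y. frechet_derivative g (at y) u) (at x) v"

definition hessian :: "('a::euclidean_space \<Rightarrow> real) \<Rightarrow> 'a \<Rightarrow> 'a \<Rightarrow> 'a" where
  "hessian g x v = (\<Sum>b\<in>Basis. second_deriv g x b v *\<^sub>R b)"

definition hessian_rank :: "('a::euclidean_space \<Rightarrow> real) \<Rightarrow> 'a \<Rightarrow> nat" where
  "hessian_rank g x = dim (range (hessian g x))"

text \<open>R^m is modelled as the span of m standard basis vectors B of the ambient space
  (coordinate projection proj_on B); a map phi defined on U \<subseteq> span B is C^k iff
  phi \<circ> proj_on B is C^k on the open set proj_on B -` U.\<close>
definition proj_on :: "'a::euclidean_space set \<Rightarrow> 'a \<Rightarrow> 'a" where
  "proj_on B y = (\<Sum>b\<in>B. (y \<bullet> b) *\<^sub>R b)"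

definition submanifold :: "nat \<Rightarrow> nat \<Rightarrow> 'a::euclidean_space set \<Rightarrow> bool" where
  "submanifold k m N \<longleftrightarrow>
    (\<forall>x\<in>N. \<exists>B U V (\<phi>::'a \<Rightarrow> 'a).
        B \<subseteq> Basis \<and> card B = m \<and>
        U \<subseteq> span B \<and> openin (top_of_set (span B)) U \<and> 0 \<in> U \<and>
        open V \<and>
        Ck_vec_on k {y. proj_on B y \<in> U} (\<phi> \<circ> proj_on B) \<and>
        \<phi> 0 = x \<and> \<phi> ` U = N \<inter> V \<and>
        (\<exists>\<psi>::'a \<Rightarrow> 'a. homeomorphism U (\<phi> ` U) \<phi> \<psi>) \<and>
        inj_on (frechet_derivative (\<phi> \<circ> proj_on B) (at 0)) (span B))"

definition NHC :: "('a::euclidean_space \<Rightarrow> real) \<Rightarrow> 'a set \<Rightarrow> 'a \<Rightarrow> bool" where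
  "NHC f Z x0 \<longleftrightarrow>
    (\<exists>d0 N k. d0 \<le> DIM('a) \<and> k \<ge> 1 \<and> submanifold k d0 N \<and> x0 \<in> N \<and> N \<subseteq> Z \<and>
       hessian_rank f x0 = DIM('a) - d0)"

definition positive_definite_hessian :: "('a::euclidean_space \<Rightarrow> real) \<Rightarrow> 'a \<Rightarrow> bool" where
  "positive_definite_hessian f x0 \<longleftrightarrow> (\<forall>v. v \<noteq> 0 \<longrightarrow> v \<bullet> hessian f x0 v > 0)"

text \<open>Sum-of-squares decomposition on \<Omega> with a countable (\<subseteq> nat) index set I,
  C^q functions, locally finite support (supports taken in the space \<Omega>).\<close>
definition SOS_decomp ::
  "nat \<Rightarrow> 'a::euclidean_space set \<Rightarrow> ('a \<Rightarrow> real) \<Rightarrow> nat set \<Rightarrow> (nat \<Rightarrow> 'a \<Rightarrow> real) \<Rightarrow> bool" where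
  "SOS_decomp q \<Omega> f I fs \<longleftrightarrow>
    (\<forall>i\<in>I. Ck_on q \<Omega> (fs i)) \<and>
    (\<forall>x\<in>\<Omega>. \<exists>W. open W \<and> x \<in> W \<and>
        finite {i\<in>I. W \<inter> \<Omega> \<inter> closure {y\<in>\<Omega>. fs i y \<noteq> 0} \<noteq> {}}) \<and>
    (\<forall>x\<in>\<Omega>. ((\<lambda>i. (fs i x)\<^sup>2) has_sum f x) I)"

end

theory Submission
  imports Defs
begin

text \<open>
  Near a zero \<open>x\<^sub>0\<close> the function is reduced by completing squares, one coordinate at a time. If
  \<open>\<partial>\<^sub>b\<^sup>2 g(x\<^sub>0) > 0\<close>, the equation \<open>\<partial>\<^sub>b g = 0\<close> determines the \<open>b\<close>-coordinate as a \<open>C\<^sup>p\<^sup>-\<^sup>1\<close> function of the others;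
  Taylor's formula around this minimum gives \<open>g = h + F\<^sup>2\<close>, where \<open>h\<close>, the minimum of \<open>g\<close> over that coordinate,
  is again \<open>C\<^sup>p\<close> and non-negative, and \<open>F\<close> is \<open>C\<^sup>p\<^sup>-\<^sup>2\<close>. A positive semidefinite Hessian with zero diagonal
  vanishes, so this Gaussian elimination stops exactly when the Hessian of the remainder \<open>h\<close> is zero, after
  \<open>rank (\<nabla>\<^sup>2 f(x\<^sub>0))\<close> steps. The tangent space of \<open>N\<close> is the kernel of the Hessian, hence \<open>N\<close> projects onto
  a neighbourhood in the remaining coordinates, and as \<open>h\<close> vanishes on this projection, \<open>h = 0\<close> near \<open>x\<^sub>0\<close>.
  So \<open>f\<close> is locally a sum of at most \<open>d\<close> squares; away from the zeros one square \<open>(\<surd>f)\<^sup>2\<close> suffices.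

  The local decompositions are glued with \<open>C\<^sup>p\<^sup>-\<^sup>2\<close> functions whose squares form a partition of unity. If the
  zeros are isolated, disjoint balls around all of them serve as a single chart with \<open>d\<close> functions, and
  the set \<open>f > 0\<close> contributes one more.
\<close>

section \<open>Calculus of the classes Ck\<close>

lemma Ck_on_subset: "Ck_on k S g \<Longrightarrow> T \<subseteq> S \<Longrightarrow> Ck_on k T g"
  by (induction k arbitrary: g) (auto intro: continuous_on_subset)

lemma Ck_on_Suc_imp: "Ck_on (Suc k) S g \<Longrightarrow> Ck_on k S g"
proof (induction k arbitrary: g)
  case 0
  then show ?case
    by (auto intro!: continuous_at_imp_continuous_on differentiable_imp_continuous_within)
next
  case (Suc k)
  then show ?case
    by (simp only: Ck_on.simps(2)) blast
qed

lemma Ck_on_le: "Ck_on m S g \<Longrightarrow> k \<le> m \<Longrightarrow> Ck_on k S g"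
  by (induction m) (auto simp: le_Suc_eq simp del: Ck_on.simps dest: Ck_on_Suc_imp)

lemma Ck_on_imp_continuous_on: "Ck_on k S g \<Longrightarrow> continuous_on S g"
  using Ck_on_le[of k S g 0] by simp

lemma Ck_on_has_derivative:
  "Ck_on (Suc k) S g \<Longrightarrow> x \<in> S \<Longrightarrow> (g has_derivative frechet_derivative g (at x)) (at x)"
  by (simp flip: frechet_derivative_works)

text \<open>Openness of \<open>S\<close> lets agreement on \<open>S\<close> pass to the derivatives,
  which see a neighbourhood of each point; the induction then descends.\<close>

lemma Ck_on_cong:
  assumes "open S" "\<And>x. x \<in> S \<Longrightarrow> g x = h x" "Ck_on k S g"
  shows "Ck_on k S h"
  using assms(2,3)
proof (induction k arbitrary: g h)
  case 0
  then show ?case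
    using continuous_on_cong[of S S g h] by simp
next
  case (Suc k)
  have der: "(h has_derivative frechet_derivative g (at x)) (at x)" if "x \<in> S" for x
    using has_derivative_transform_within_open[OF Ck_on_has_derivative[OF Suc.prems(2) that] \<open>open S\<close> that]
      Suc.prems(1) by simp
  then have eq: "frechet_derivative g (at x) = frechet_derivative h (at x)" if "x \<in> S" for x
    using frechet_derivative_at that by blast
  have "h differentiable (at x)" if "x \<in> S" for x
    using der[OF that] by (auto simp: differentiable_def)
  moreover have "Ck_on k S (\<lambda>x. frechet_derivative h (at x) b)" if "b \<in> Basis" for b
    using Suc.IH[of "\<lambda>x. frechet_derivative g (at x) b" "\<lambda>x. frechet_derivative h (at x) b"]
      Suc.prems(2) that eq by simp
  ultimately show ?case by simp
qed

text \<open>Introduction rule behind most closure properties: derivatives are unique, so any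
  explicit formula \<open>D\<close> may replace the choice term
  \<open>frechet_derivative\<close>.\<close>

lemma Ck_on_SucI:
  assumes "open S" "\<And>x. x \<in> S \<Longrightarrow> (g has_derivative D x) (at x)"
    and "\<And>b. b \<in> Basis \<Longrightarrow> Ck_on k S (\<lambda>x. D x b)"
  shows "Ck_on (Suc k) S g"
proof -
  have "frechet_derivative g (at x) = D x" if "x \<in> S" for x
    using assms(2)[OF that] frechet_derivative_at by metis
  then have "Ck_on k S (\<lambda>x. frechet_derivative g (at x) b)" if "b \<in> Basis" for b
    by (intro Ck_on_cong[OF assms(1) _ assms(3)[OF that]]) simp
  then show ?thesis
    using assms(2) by (auto simp: differentiable_def)
qed

text \<open>Needed for functions given by different formulas on different open pieces, as happens in
  every gluing step below.\<close>

lemma Ck_on_local: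
  assumes "\<And>x. x \<in> S \<Longrightarrow> \<exists>T. open T \<and> x \<in> T \<and> Ck_on k (T \<inter> S) g" and "open S"
  shows "Ck_on k S g"
  using assms(1)
proof (induction k arbitrary: g)
  case 0
  have "continuous (at x) g" if x: "x \<in> S" for x
  proof -
    obtain T where "open T" "x \<in> T" "continuous_on (T \<inter> S) g"
      using 0[OF x] by auto
    then show ?thesis
      using \<open>open S\<close> x by (simp add: continuous_on_eq_continuous_at open_Int)
  qed
  then show ?case
    by (simp add: continuous_at_imp_continuous_on)
next
  case (Suc k)
  have "Ck_on k S (\<lambda>x. frechet_derivative g (at x) b)" if "b \<in> Basis" for b
  proof (rule Suc.IH)
    fix x assume "x \<in> S"
    from Suc.prems[OF this] that
    show "\<exists>T. open T \<and> x \<in> T \<and> Ck_on k (T \<inter> S) (\<lambda>x. frechet_derivative g (at x) b)"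
      by auto
  qed
  then show ?case
    using Suc.prems by simp blast
qed

section \<open>Closure of the classes under algebraic operations and roots\<close>

lemma Ck_on_const: "Ck_on k S (\<lambda>x. c)"
  by (induction k arbitrary: c) auto

lemma Ck_on_add:
  assumes "open S" "Ck_on k S g" "Ck_on k S h"
  shows "Ck_on k S (\<lambda>x. g x + h x)"
  using assms(2,3)
proof (induction k arbitrary: g h)
  case 0
  then show ?case by (simp add: continuous_on_add)
next
  case (Suc k)
  then show ?case
    by (intro Ck_on_SucI[OF assms(1), of _
          "\<lambda>x v. frechet_derivative g (at x) v + frechet_derivative h (at x) v"]
        has_derivative_add Ck_on_has_derivative) auto
qed

lemma Ck_on_mult:
  assumes "open S" "Ck_on k S g" "Ck_on k S h"
  shows "Ck_on k S (\<lambda>x. g x * h x)"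
  using assms(2,3)
proof (induction k arbitrary: g h)
  case 0
  then show ?case by (simp add: continuous_on_mult)
next
  case (Suc k)
  show ?case
  proof (rule Ck_on_SucI[OF assms(1), of _
          "\<lambda>x v. g x * frechet_derivative h (at x) v + frechet_derivative g (at x) v * h x"])
    show "((\<lambda>x. g x * h x) has_derivative
      (\<lambda>v. g x * frechet_derivative h (at x) v + frechet_derivative g (at x) v * h x)) (at x)"
      if "x \<in> S" for x
      using Suc.prems that by (intro has_derivative_mult Ck_on_has_derivative)
  next
    fix b :: 'a assume "b \<in> Basis"
    then show "Ck_on k S (\<lambda>x. g x * frechet_derivative h (at x) b + frechet_derivative g (at x) b * h x)"
      using Suc.prems Ck_on_Suc_imp[of k S g] Ck_on_Suc_imp[of k S h]
      by (intro Ck_on_add[OF assms(1)] Suc.IH) simp_all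
  qed
qed

lemma Ck_on_minus:
  assumes "open S" "Ck_on k S g"
  shows "Ck_on k S (\<lambda>x. - g x)"
  using Ck_on_mult[OF assms(1) Ck_on_const[of _ _ "-1"] assms(2)] by simp

lemma Ck_on_diff:
  assumes "open S" "Ck_on k S g" "Ck_on k S h"
  shows "Ck_on k S (\<lambda>x. g x - h x)"
  using Ck_on_add[OF assms(1,2) Ck_on_minus[OF assms(1,3)]] by simp

lemma Ck_on_sum:
  assumes "open S" "\<And>i. i \<in> I \<Longrightarrow> Ck_on k S (g i)"
  shows "Ck_on k S (\<lambda>x. \<Sum>i\<in>I. g i x)"
  using assms(2)
  by (induction I rule: infinite_finite_induct) (auto intro!: Ck_on_const Ck_on_add[OF assms(1)])

lemma Ck_on_prod:
  assumes "open S" "\<And>i. i \<in> I \<Longrightarrow> Ck_on k S (g i)"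
  shows "Ck_on k S (\<lambda>x. \<Prod>i\<in>I. g i x)"
  using assms(2)
  by (induction I rule: infinite_finite_induct) (auto intro!: Ck_on_const Ck_on_mult[OF assms(1)])

lemma Ck_on_power2:
  assumes "open S" "Ck_on k S g"
  shows "Ck_on k S (\<lambda>x. (g x)\<^sup>2)"
  using Ck_on_mult[OF assms assms(2)] by (simp add: power2_eq_square)

lemma Ck_on_inner_left:
  assumes "open S"
  shows "Ck_on k S (\<lambda>x. x \<bullet> c)"
proof (cases k)
  case 0
  then show ?thesis
    by (simp add: continuous_on_inner continuous_on_id continuous_on_const)
next
  case (Suc m)
  then show ?thesis
    by (simp only: Suc)
      (intro Ck_on_SucI[OF assms, of _ "\<lambda>x v. v \<bullet> c"] Ck_on_const bounded_linear_imp_has_derivative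
        bounded_linear_inner_left)
qed

text \<open>The derivative of the reciprocal is a polynomial in the reciprocal and the derivative of
  \<open>g\<close>, so each class already reached yields the next one. Square roots are treated in
  the same way.\<close>

lemma Ck_on_inverse:
  assumes "open S" "Ck_on k S g" "\<And>x. x \<in> S \<Longrightarrow> g x \<noteq> 0"
  shows "Ck_on k S (\<lambda>x. inverse (g x))"
  using assms(2)
proof (induction k)
  case 0
  then show ?case
    using assms(3) by (simp add: continuous_on_inverse)
next
  case (Suc k)
  have "Ck_on k S (\<lambda>x. inverse (g x))"
    using Suc by (simp add: Ck_on_Suc_imp del: Ck_on.simps)
  moreover have "Ck_on k S (\<lambda>x. frechet_derivative g (at x) b)" if "b \<in> Basis" for b
    using Suc.prems that by simp
  moreover have "((\<lambda>x. inverse (g x)) has_derivative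
      (\<lambda>v. - (inverse (g x) * frechet_derivative g (at x) v * inverse (g x)))) (at x)"
    if "x \<in> S" for x
    using Deriv.has_derivative_inverse[OF assms(3)[OF that] Ck_on_has_derivative[OF Suc.prems that]] .
  ultimately show ?case
    by (intro Ck_on_SucI[OF assms(1), of _
          "\<lambda>x v. - (inverse (g x) * frechet_derivative g (at x) v * inverse (g x))"]
        Ck_on_minus Ck_on_mult assms(1)) simp_all
qed

lemma Ck_on_divide:
  assumes "open S" "Ck_on k S g" "Ck_on k S h" "\<And>x. x \<in> S \<Longrightarrow> h x \<noteq> 0"
  shows "Ck_on k S (\<lambda>x. g x / h x)"
  using Ck_on_mult[OF assms(1,2) Ck_on_inverse[OF assms(1,3,4)]] by (simp add: divide_inverse)

lemma Ck_on_sqrt: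
  assumes "open S" "Ck_on k S g" "\<And>x. x \<in> S \<Longrightarrow> g x > 0"
  shows "Ck_on k S (\<lambda>x. sqrt (g x))"
  using assms(2)
proof (induction k)
  case 0
  then show ?case
    by (simp add: continuous_on_real_sqrt)
next
  case (Suc k)
  have "Ck_on k S (\<lambda>x. sqrt (g x))"
    using Suc by (simp add: Ck_on_Suc_imp del: Ck_on.simps)
  then have "Ck_on k S (\<lambda>x. inverse (sqrt (g x)) / 2 * frechet_derivative g (at x) b)"
    if "b \<in> Basis" for b
    using Suc.prems that assms(3)
    by (intro Ck_on_mult Ck_on_divide Ck_on_inverse Ck_on_const assms(1)) fastforce+
  moreover have "((\<lambda>x. sqrt (g x)) has_derivative
      (\<lambda>v. inverse (sqrt (g x)) / 2 * frechet_derivative g (at x) v)) (at x)" if "x \<in> S" for x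
    using has_derivative_compose[OF Ck_on_has_derivative[OF Suc.prems that]
        DERIV_real_sqrt[unfolded has_field_derivative_def, OF assms(3)[OF that]]] .
  ultimately show ?case
    by (intro Ck_on_SucI[OF assms(1), of _
          "\<lambda>x v. inverse (sqrt (g x)) / 2 * frechet_derivative g (at x) v"])
qed

lemma has_real_derivative_max_0_power:
  "((\<lambda>s::real. max 0 s ^ Suc (Suc m)) has_real_derivative real (Suc (Suc m)) * max 0 s ^ Suc m) (at s)"
proof -
  let ?P = "\<lambda>s::real. max 0 s ^ Suc (Suc m)"
  consider "s < 0" | "s > 0" | "s = 0" by linarith
  then show ?thesis
  proof cases
    case 1
    have "(?P has_real_derivative 0) (at s)"
      by (rule has_field_derivative_transform_within_open[of "\<lambda>_. 0" _ _ "{..<0}"])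
        (use 1 in \<open>auto intro!: derivative_eq_intros\<close>)
    then show ?thesis using 1 by simp
  next
    case 2
    have "(?P has_real_derivative real (Suc (Suc m)) * s ^ Suc m) (at s)"
      by (rule has_field_derivative_transform_within_open[of "\<lambda>s. s ^ Suc (Suc m)" _ _ "{0<..}"])
        (use 2 DERIV_pow[of "Suc (Suc m)" s] in auto)
    then show ?thesis using 2 by simp
  next
    \<comment> \<open>At the kink the difference quotient is dominated by a positive power of
      \<open>\<bar>h\<bar>\<close>.\<close>
    case 3
    have "((\<lambda>h. max 0 h ^ Suc (Suc m) / h) \<longlongrightarrow> 0) (at (0::real))"
    proof (rule Lim_null_comparison[of _ "\<lambda>h. \<bar>h\<bar> ^ Suc m"])
      have "norm (max 0 h ^ Suc (Suc m) / h) \<le> \<bar>h\<bar> ^ Suc m" for h :: real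
        by (cases "h > 0") (auto simp: max_def mult_nonpos_nonneg)
      then show "\<forall>\<^sub>F h in at (0::real). norm (max 0 h ^ Suc (Suc m) / h) \<le> \<bar>h\<bar> ^ Suc m"
        by simp
      show "((\<lambda>h::real. \<bar>h\<bar> ^ Suc m) \<longlongrightarrow> 0) (at 0)"
        by (auto intro!: tendsto_eq_intros)
    qed
    then show ?thesis
      using 3 by (simp add: DERIV_def)
  qed
qed

text \<open>Finite smoothness is all that the cutoffs require, so truncated powers take the place of
  exponential bump functions.\<close>

lemma Ck_on_max_0_power:
  assumes "open S" "Ck_on k S g" "m > k"
  shows "Ck_on k S (\<lambda>x. max 0 (g x) ^ m)"
  using assms(2,3)
proof (induction k arbitrary: m)
  case 0
  then show ?case
    by (simp add: continuous_on_max continuous_on_power continuous_on_const)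
next
  case (Suc k)
  define n where "n = m - 2"
  have m: "m = Suc (Suc n)" "k < Suc n"
    using Suc.prems(2) by (simp_all add: n_def)
  have "Ck_on k S (\<lambda>x. max 0 (g x) ^ Suc n)"
    using Suc.IH[OF Ck_on_Suc_imp[OF Suc.prems(1)] m(2)] .
  moreover have "Ck_on k S (\<lambda>x. frechet_derivative g (at x) b)" if "b \<in> Basis" for b
    using Suc.prems that by simp
  moreover have "((\<lambda>x. max 0 (g x) ^ m) has_derivative
      (\<lambda>v. (real m * max 0 (g x) ^ Suc n) * frechet_derivative g (at x) v)) (at x)" if "x \<in> S" for x
    using has_derivative_compose[OF Ck_on_has_derivative[OF Suc.prems(1) that]
        has_real_derivative_max_0_power[unfolded has_field_derivative_def], of n]
    by (simp add: m mult_ac)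
  ultimately show ?case
    by (intro Ck_on_SucI[OF assms(1), of _
          "\<lambda>x v. (real m * max 0 (g x) ^ Suc n) * frechet_derivative g (at x) v"]
         Ck_on_mult assms(1) Ck_on_const)
qed

text \<open>The factor \<open>s\<close> covers both uses: \<open>s = 1\<close> for substituting the
  solution of an implicit equation, and \<open>s\<close> between 0 and 1 for integrals along the
  segment towards it.\<close>

lemma has_derivative_compose_shift:
  fixes u t :: "'a::euclidean_space \<Rightarrow> real"
  assumes "(t has_derivative t') (at x)" "(u has_derivative u') (at (x - (s * t x) *\<^sub>R b))"
  shows "((\<lambda>x. u (x - (s * t x) *\<^sub>R b)) has_derivative (\<lambda>v. u' v - s * t' v * u' b)) (at x)"
proof -
  have lin: "linear u'"
    using assms(2) has_derivative_linear by blast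
  have "((\<lambda>x. x - (s * t x) *\<^sub>R b) has_derivative (\<lambda>v. v - (s * t' v) *\<^sub>R b)) (at x)"
    by (auto intro!: derivative_eq_intros assms(1))
  from has_derivative_compose[OF this assms(2)] show ?thesis
    by (simp add: linear_diff[OF lin] linear_scale[OF lin])
qed

text \<open>The inner map changes one coordinate only, so the chain rule stays among scalar
  functions. As \<open>b\<close> is a basis vector, the extra factor is again a partial derivative
  controlled by \<open>Ck_on\<close>.\<close>

lemma Ck_on_compose_shift:
  fixes u t :: "'a::euclidean_space \<Rightarrow> real"
  assumes "open S" "b \<in> Basis" "Ck_on k T u" "Ck_on k S t"
    and "\<And>x. x \<in> S \<Longrightarrow> x - t x *\<^sub>R b \<in> T"
  shows "Ck_on k S (\<lambda>x. u (x - t x *\<^sub>R b))"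
  using assms(3,4)
proof (induction k arbitrary: u)
  case 0
  then show ?case
    using assms(5) continuous_on_compose2[of T u S "\<lambda>x. x - t x *\<^sub>R b"]
    by (simp add: continuous_on_diff continuous_on_scaleR image_subset_iff)
next
  case (Suc k)
  let ?u = "\<lambda>b x. frechet_derivative u (at x) b"
  have "Ck_on k S (\<lambda>x. ?u c (x - t x *\<^sub>R b))" if "c \<in> Basis" for c
    using Suc.IH[of "?u c"] Suc.prems that Ck_on_Suc_imp[OF Suc.prems(2)] by simp
  moreover have "Ck_on k S (\<lambda>x. frechet_derivative t (at x) c)" if "c \<in> Basis" for c
    using Suc.prems that by simp
  moreover have "((\<lambda>x. u (x - t x *\<^sub>R b)) has_derivative
     (\<lambda>v. ?u v (x - t x *\<^sub>R b) - frechet_derivative t (at x) v * ?u b (x - t x *\<^sub>R b))) (at x)"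
    if "x \<in> S" for x
    using has_derivative_compose_shift[of t _ x u _ 1 b,
        OF Ck_on_has_derivative[OF Suc.prems(2) that]] Ck_on_has_derivative[OF Suc.prems(1)]
      assms(5)[OF that] by simp
  ultimately show ?case
    using \<open>b \<in> Basis\<close>
    by (intro Ck_on_SucI[OF assms(1), of _ "\<lambda>x v. ?u v (x - t x *\<^sub>R b) -
         frechet_derivative t (at x) v * ?u b (x - t x *\<^sub>R b)"] Ck_on_diff Ck_on_mult assms(1)) auto
qed

section \<open>Parametric integrals and mixed partial derivatives\<close>

lemma linear_real_expansion:
  fixes L :: "'a::euclidean_space \<Rightarrow> real"
  assumes "linear L"
  shows "L v = (\<Sum>c\<in>Basis. L c * (v \<bullet> c))"
proof -
  have "L v = L (\<Sum>c\<in>Basis. (v \<bullet> c) *\<^sub>R c)"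
    by (simp add: euclidean_representation)
  then show ?thesis
    by (simp add: linear_sum[OF assms] linear_scale[OF assms] mult.commute)
qed

lemma continuous_on_Pair_section:
  assumes "continuous_on (S \<times> T) (\<lambda>(x, s). f x s)" "x \<in> S"
  shows "continuous_on T (f x)"
  using continuous_on_compose2[OF assms(1), of T "Pair x"] assms(2)
  by (simp add: continuous_on_Pair image_subset_iff)

lemma continuous_on_weighted_shift:
  fixes u t :: "'a::euclidean_space \<Rightarrow> real" and w :: "real \<Rightarrow> real"
  assumes "continuous_on T u" "continuous_on S t" "continuous_on {0..1} w"
    and "\<And>x s. x \<in> S \<Longrightarrow> s \<in> {0..1} \<Longrightarrow> x - (s * t x) *\<^sub>R b \<in> T"
  shows "continuous_on (S \<times> {0..1}) (\<lambda>(x, s). w s * u (x - (s * t x) *\<^sub>R b))"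
proof -
  have t: "continuous_on (S \<times> {0..1::real}) (\<lambda>z. t (fst z))"
    by (rule continuous_on_compose2[OF assms(2)]) (auto intro: continuous_on_fst continuous_on_id)
  have w: "continuous_on (S \<times> {0..1::real}) (\<lambda>z. w (snd z))"
    by (rule continuous_on_compose2[OF assms(3)]) (auto intro: continuous_on_snd continuous_on_id)
  have "continuous_on (S \<times> {0..1::real}) (\<lambda>z. u (fst z - (snd z * t (fst z)) *\<^sub>R b))"
    by (rule continuous_on_compose2[OF assms(1)])
      (use assms(4) in \<open>auto intro!: continuous_on_diff continuous_on_scaleR continuous_on_mult t
          continuous_on_fst continuous_on_snd continuous_on_id continuous_on_const\<close>)
  then show ?thesis
    unfolding case_prod_beta by (intro continuous_on_mult w)
qed

text \<open>Differentiation under the integral produces a term whose weight has gained a factor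
  \<open>s\<close>; the induction therefore runs over all continuous weights \<open>w\<close> at
  once.\<close>

lemma Ck_on_integral_shift:
  fixes u t :: "'a::euclidean_space \<Rightarrow> real" and w :: "real \<Rightarrow> real"
  assumes "open S" "b \<in> Basis" "Ck_on k T u" "Ck_on k S t" "continuous_on {0..1} w"
    and seg: "\<And>x s. x \<in> S \<Longrightarrow> s \<in> {0..1} \<Longrightarrow> x - (s * t x) *\<^sub>R b \<in> T"
  shows "Ck_on k S (\<lambda>x. integral {0..1} (\<lambda>s. w s * u (x - (s * t x) *\<^sub>R b)))"
  using assms(3-5)
proof (induction k arbitrary: u w)
  case 0
  then have "continuous_on (S \<times> {0..1}) (\<lambda>(x, s). w s * u (x - (s * t x) *\<^sub>R b))"
    using seg by (intro continuous_on_weighted_shift[of T]) auto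
  then show ?case
    using integral_continuous_on_param[of S 0 1 "\<lambda>x s. w s * u (x - (s * t x) *\<^sub>R b)"] by simp
next
  case (Suc k)
  let ?u = "\<lambda>c x. frechet_derivative u (at x) c"
  let ?t = "\<lambda>c x. frechet_derivative t (at x) c"
  have Cu: "Ck_on k T (?u c)" and Ct: "Ck_on k S (?t c)" if "c \<in> Basis" for c
    using Suc.prems that by simp_all
  have Ct0: "Ck_on k S t"
    using Suc.prems Ck_on_Suc_imp by blast
  have ct: "continuous_on S t"
    using Suc.prems Ck_on_imp_continuous_on by blast
  have ws: "continuous_on {0..1} (\<lambda>s. w s * s)"
    using Suc.prems by (intro continuous_on_mult continuous_on_id)
  have cont: "continuous_on (S \<times> {0..1}) (\<lambda>(x, s). w s * ?u c (x - (s * t x) *\<^sub>R b))"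
    "continuous_on (S \<times> {0..1}) (\<lambda>(x, s). w s * s * ?u c (x - (s * t x) *\<^sub>R b))"
    if "c \<in> Basis" for c
    using Ck_on_imp_continuous_on[OF Cu[OF that]] Suc.prems(3) ws ct seg
    by (intro continuous_on_weighted_shift[of T]; simp)+
  define coef where "coef c x s = w s * ?u c (x - (s * t x) *\<^sub>R b)
      - ?t c x * (w s * s * ?u b (x - (s * t x) *\<^sub>R b))" for c x s
  have cont_coef: "continuous_on (S \<times> {0..1}) (\<lambda>(x, s). coef c x s)" if "c \<in> Basis" for c
  proof -
    have "continuous_on (S \<times> {0..1}) (\<lambda>z. ?t c (fst z))"
      by (rule continuous_on_compose2[OF Ck_on_imp_continuous_on[OF Ct[OF that]]])
        (auto intro: continuous_on_fst continuous_on_id)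
    from continuous_on_diff[OF cont(1)[OF that, unfolded case_prod_beta] continuous_on_mult[OF this
          cont(2)[OF \<open>b \<in> Basis\<close>, unfolded case_prod_beta]]]
    show ?thesis
      unfolding coef_def case_prod_beta .
  qed
  \<comment> \<open>The Leibniz rule asks for a continuous family of bounded linear maps; it is
    assembled from the partial derivatives \<open>coef\<close> of the integrand.\<close>
  define fx where "fx x s = (\<Sum>c\<in>Basis. coef c x s *\<^sub>R blinfun_inner_left c)" for x s
  have cont_fx: "continuous_on (S \<times> {0..1}) (\<lambda>(x, s). fx x s)"
    using cont_coef unfolding fx_def case_prod_beta
    by (intro continuous_on_sum continuous_on_scaleR continuous_on_const) auto
  have fx_Basis: "blinfun_apply (fx x s) c = coef c x s" if "c \<in> Basis" for x s c
  proof -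
    have "blinfun_apply (fx x s) c = (\<Sum>c'\<in>Basis. if c = c' then coef c' x s else 0)"
      unfolding fx_def blinfun.sum_left
      by (intro sum.cong) (auto simp: blinfun.scaleR_left inner_Basis that)
    then show ?thesis
      using that by simp
  qed
  have der: "((\<lambda>x. w s * u (x - (s * t x) *\<^sub>R b)) has_derivative blinfun_apply (fx x s)) (at x)"
    if "x \<in> S" "s \<in> {0..1}" for x s
  proof -
    let ?D = "\<lambda>v. w s * (?u v (x - (s * t x) *\<^sub>R b) - s * ?t v x * ?u b (x - (s * t x) *\<^sub>R b))"
    have D: "((\<lambda>x. w s * u (x - (s * t x) *\<^sub>R b)) has_derivative ?D) (at x)"
      using that(1) seg[OF that] by (intro has_derivative_mult_right has_derivative_compose_shift
          Ck_on_has_derivative[OF Suc.prems(1)] Ck_on_has_derivative[OF Suc.prems(2)])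
    have "?D c = coef c x s" for c
      by (simp add: coef_def algebra_simps)
    then have "?D v = blinfun_apply (fx x s) v" for v
      using linear_real_expansion[OF has_derivative_linear[OF D], of v]
      by (simp add: fx_def blinfun.sum_left blinfun.scaleR_left)
    then have "?D = blinfun_apply (fx x s)" by (rule ext)
    then show ?thesis using D by simp
  qed
  have int_fx: "fx x integrable_on {0..1}" if "x \<in> S" for x
    using continuous_on_Pair_section[OF cont_fx that] by (simp add: integrable_continuous_real)
  let ?J = "\<lambda>x. integral {0..1} (\<lambda>s. w s * u (x - (s * t x) *\<^sub>R b))"
  have J_der: "(?J has_derivative blinfun_apply (integral {0..1} (fx x))) (at x)" if x: "x \<in> S" for x
  proof -
    obtain e where e: "e > 0" "ball x e \<subseteq> S"
      using \<open>open S\<close> x openE by blast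
    have cont0: "continuous_on (S \<times> {0..1}) (\<lambda>(x, s). w s * u (x - (s * t x) *\<^sub>R b))"
      using Ck_on_imp_continuous_on[OF Suc.prems(1)] ct Suc.prems(3) seg
      by (rule continuous_on_weighted_shift)
    \<comment> \<open>The rule needs a convex parameter domain, hence the ball inside
      \<open>S\<close>.\<close>
    have "((\<lambda>x. integral (cbox 0 1) (\<lambda>s. w s * u (x - (s * t x) *\<^sub>R b))) has_derivative
        blinfun_apply (integral (cbox 0 1) (fx x))) (at x within ball x e)"
    proof (rule leibniz_rule)
      fix y s assume y: "y \<in> ball x e" and "s \<in> cbox 0 (1::real)"
      then have "y \<in> S" "s \<in> {0..1}"
        using e by auto
      from der[OF this]
      show "((\<lambda>x. w s * u (x - (s * t x) *\<^sub>R b)) has_derivative blinfun_apply (fx y s)) (at y within ball x e)"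
        by (rule has_derivative_at_withinI)
    next
      show "(\<lambda>s. w s * u (y - (s * t y) *\<^sub>R b)) integrable_on cbox 0 1" if "y \<in> ball x e" for y
        unfolding cbox_interval using that e
        by (intro integrable_continuous_real continuous_on_Pair_section[OF cont0]) blast
      show "continuous_on (ball x e \<times> cbox 0 1) (\<lambda>(x, s). fx x s)"
        by (rule continuous_on_subset[OF cont_fx]) (use e in auto)
    qed (use e in simp_all)
    then show ?thesis
      using e(1) by (simp only: cbox_interval at_within_open[of x "ball x e"] centre_in_ball open_ball)
  qed
  show ?case
  proof (rule Ck_on_SucI[OF \<open>open S\<close> J_der])
    fix c :: 'a assume c: "c \<in> Basis"
    have "blinfun_apply (integral {0..1} (fx x)) c =
        integral {0..1} (\<lambda>s. w s * ?u c (x - (s * t x) *\<^sub>R b))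
        - ?t c x * integral {0..1} (\<lambda>s. w s * s * ?u b (x - (s * t x) *\<^sub>R b))" if "x \<in> S" for x
    proof -
      have i: "(\<lambda>s. w s * ?u c (x - (s * t x) *\<^sub>R b)) integrable_on {0..1}"
        "(\<lambda>s. w s * s * ?u b (x - (s * t x) *\<^sub>R b)) integrable_on {0..1}"
        using continuous_on_Pair_section[OF cont(1)[OF c] that]
          continuous_on_Pair_section[OF cont(2)[OF \<open>b \<in> Basis\<close>] that]
        by (simp_all add: integrable_continuous_real)
      have "blinfun_apply (integral {0..1} (fx x)) c = integral {0..1} (\<lambda>s. coef c x s)"
        using blinfun_apply_integral[OF int_fx[OF that]] fx_Basis[OF c] by simp
      also have "\<dots> = integral {0..1} (\<lambda>s. w s * ?u c (x - (s * t x) *\<^sub>R b))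
        - integral {0..1} (\<lambda>s. ?t c x * (w s * s * ?u b (x - (s * t x) *\<^sub>R b)))"
        unfolding coef_def
        by (rule Henstock_Kurzweil_Integration.integral_diff[OF i(1) integrable_on_mult_right[OF i(2)]])
      finally show ?thesis by simp
    qed
    moreover have "Ck_on k S (\<lambda>x. integral {0..1} (\<lambda>s. w s * ?u c (x - (s * t x) *\<^sub>R b))
        - ?t c x * integral {0..1} (\<lambda>s. w s * s * ?u b (x - (s * t x) *\<^sub>R b)))"
      using Suc.IH[OF Cu[OF c] Ct0 Suc.prems(3)] Ct[OF c] Suc.IH[OF Cu[OF \<open>b \<in> Basis\<close>] Ct0 ws]
      by (intro Ck_on_diff Ck_on_mult \<open>open S\<close>)
    ultimately show "Ck_on k S (\<lambda>x. blinfun_apply (integral {0..1} (fx x)) c)"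
      using Ck_on_cong[OF \<open>open S\<close>] by (metis (no_types, lifting))
  qed
qed

section \<open>Symmetry of second derivatives\<close>

lemma has_real_derivative_along_line:
  assumes "Ck_on (Suc k) S g" "x + s *\<^sub>R v \<in> S"
  shows "((\<lambda>s. g (x + s *\<^sub>R v)) has_real_derivative frechet_derivative g (at (x + s *\<^sub>R v)) v) (at s)"
proof -
  have D: "(g has_derivative frechet_derivative g (at (x + s *\<^sub>R v))) (at (x + s *\<^sub>R v))"
    using Ck_on_has_derivative[OF assms] .
  have "((\<lambda>s. x + s *\<^sub>R v) has_derivative (\<lambda>h. h *\<^sub>R v)) (at s)"
    by (auto intro!: derivative_eq_intros)
  from has_derivative_compose[OF this D] show ?thesis
    unfolding has_field_derivative_def
    by (simp add: linear_scale[OF has_derivative_linear[OF D]] mult_commute_abs)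
qed

text \<open>The mean value theorem is applied twice: in direction \<open>b\<close> to the increment
  of \<open>g\<close> over the step along \<open>c\<close>, then in direction \<open>c\<close> to
  the resulting partial derivative.\<close>

lemma mixed_difference:
  assumes C: "Ck_on 2 S g" and e: "ball x e \<subseteq> S" and s: "0 < s" "2 * s < e"
    and b: "b \<in> Basis" and c: "c \<in> Basis"
  obtains y where "dist x y \<le> 2 * s"
    "g (x + s *\<^sub>R b + s *\<^sub>R c) - g (x + s *\<^sub>R b) - g (x + s *\<^sub>R c) + g x = s\<^sup>2 * second_deriv g y b c"
proof -
  have C2: "Ck_on (Suc (Suc 0)) S g"
    using C by (simp only: numeral_2_eq_2)
  have C1: "Ck_on (Suc 0) S (\<lambda>x. frechet_derivative g (at x) b)"
    using C2 b by (simp only: Ck_on.simps) blast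
  have nb: "norm (i *\<^sub>R b + j *\<^sub>R c) \<le> 2 * s" if "0 \<le> i" "i \<le> s" "0 \<le> j" "j \<le> s" for i j
    using norm_triangle_ineq[of "i *\<^sub>R b" "j *\<^sub>R c"] that b c by simp
  have dn: "dist x (x + (i *\<^sub>R b + j *\<^sub>R c)) = norm (i *\<^sub>R b + j *\<^sub>R c)" for i j
    by (metis add_diff_cancel_left' dist_commute dist_norm)
  have inS: "x + (i *\<^sub>R b + j *\<^sub>R c) \<in> S" if "0 \<le> i" "i \<le> s" "0 \<le> j" "j \<le> s" for i j
    using nb[OF that] dn[of i j] e s by (auto simp: subset_iff)
  define \<psi> where "\<psi> i = g ((x + s *\<^sub>R c) + i *\<^sub>R b) - g (x + i *\<^sub>R b)" for i
  let ?g = "\<lambda>y. frechet_derivative g (at y) b"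
  have "(\<psi> has_real_derivative ?g ((x + s *\<^sub>R c) + i *\<^sub>R b) - ?g (x + i *\<^sub>R b)) (at i)"
    if "0 \<le> i" "i \<le> s" for i
    unfolding \<psi>_def using inS[OF that, of s] inS[OF that, of 0] s
    by (intro DERIV_diff has_real_derivative_along_line[OF C2]) (simp_all add: algebra_simps)
  from MVT2[OF s(1) this] obtain i where i: "0 < i" "i < s"
    "\<psi> s - \<psi> 0 = s * (?g ((x + s *\<^sub>R c) + i *\<^sub>R b) - ?g (x + i *\<^sub>R b))"
    by auto
  have "((\<lambda>j. ?g ((x + i *\<^sub>R b) + j *\<^sub>R c)) has_real_derivative
      second_deriv g ((x + i *\<^sub>R b) + j *\<^sub>R c) b c) (at j)" if "0 \<le> j" "j \<le> s" for j
    unfolding second_deriv_def using inS[of i j] i that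
    by (intro has_real_derivative_along_line[OF C1]) (simp add: algebra_simps)
  from MVT2[OF s(1) this] obtain j where j: "0 < j" "j < s"
    "?g (x + i *\<^sub>R b + s *\<^sub>R c) - ?g (x + i *\<^sub>R b + 0 *\<^sub>R c)
      = s * second_deriv g (x + i *\<^sub>R b + j *\<^sub>R c) b c"
    by auto
  have "dist x (x + i *\<^sub>R b + j *\<^sub>R c) \<le> 2 * s"
    using nb[of i j] dn[of i j] i j by (simp add: add.assoc)
  moreover have "g (x + s *\<^sub>R b + s *\<^sub>R c) - g (x + s *\<^sub>R b) - g (x + s *\<^sub>R c) + g x
      = s\<^sup>2 * second_deriv g (x + i *\<^sub>R b + j *\<^sub>R c) b c"
    using i(3) j(3) by (simp add: \<psi>_def power2_eq_square algebra_simps)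
  ultimately show ?thesis using that by blast
qed

text \<open>The second difference ignores the order of \<open>b\<close> and \<open>c\<close>, so its
  two mean value representations agree at points close to \<open>x\<close>. Continuity would keep
  unequal mixed derivatives apart there.\<close>

lemma second_deriv_commute:
  assumes C: "Ck_on 2 S g" and S: "open S" "x \<in> S" and b: "b \<in> Basis" and c: "c \<in> Basis"
  shows "second_deriv g x b c = second_deriv g x c b"
proof (rule ccontr)
  assume ne: "second_deriv g x b c \<noteq> second_deriv g x c b"
  define \<epsilon> where "\<epsilon> = \<bar>second_deriv g x b c - second_deriv g x c b\<bar> / 2"
  have "\<epsilon> > 0" using ne by (simp add: \<epsilon>_def)
  have "continuous_on S (\<lambda>y. second_deriv g y b c)" "continuous_on S (\<lambda>y. second_deriv g y c b)"
    using C b c by (simp_all add: second_deriv_def numeral_2_eq_2)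
  then have "continuous (at x) (\<lambda>y. second_deriv g y b c)" "continuous (at x) (\<lambda>y. second_deriv g y c b)"
    using S by (simp_all add: continuous_on_eq_continuous_at)
  then have "\<exists>d>0. \<forall>y. dist y x < d \<longrightarrow> dist (second_deriv g y b c) (second_deriv g x b c) < \<epsilon>"
    "\<exists>d>0. \<forall>y. dist y x < d \<longrightarrow> dist (second_deriv g y c b) (second_deriv g x c b) < \<epsilon>"
    using \<open>\<epsilon> > 0\<close> by (simp_all only: continuous_at_eps_delta)
  then obtain d1 d2 where d: "d1 > 0" "d2 > 0"
    "\<And>y. dist y x < d1 \<Longrightarrow> dist (second_deriv g y b c) (second_deriv g x b c) < \<epsilon>"
    "\<And>y. dist y x < d2 \<Longrightarrow> dist (second_deriv g y c b) (second_deriv g x c b) < \<epsilon>"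
    by blast
  obtain e where e: "e > 0" "ball x e \<subseteq> S"
    using S openE by blast
  define s where "s = Min {d1, d2, e} / 3"
  have s: "0 < s" "2 * s < e" "2 * s < d1" "2 * s < d2"
    using d e by (auto simp: s_def)
  obtain y where y: "dist x y \<le> 2 * s"
    "g (x + s *\<^sub>R b + s *\<^sub>R c) - g (x + s *\<^sub>R b) - g (x + s *\<^sub>R c) + g x = s\<^sup>2 * second_deriv g y b c"
    using mixed_difference[OF C e(2) s(1,2) b c] .
  obtain z where z: "dist x z \<le> 2 * s"
    "g (x + s *\<^sub>R c + s *\<^sub>R b) - g (x + s *\<^sub>R c) - g (x + s *\<^sub>R b) + g x = s\<^sup>2 * second_deriv g z c b"
    using mixed_difference[OF C e(2) s(1,2) c b] .
  have "s\<^sup>2 * second_deriv g y b c = s\<^sup>2 * second_deriv g z c b"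
    unfolding y(2)[symmetric] z(2)[symmetric] by (simp add: algebra_simps)
  then have "second_deriv g y b c = second_deriv g z c b"
    using s by simp
  moreover have "dist (second_deriv g y b c) (second_deriv g x b c) < \<epsilon>"
    "dist (second_deriv g z c b) (second_deriv g x c b) < \<epsilon>"
    using d(3)[of y] d(4)[of z] y z s by (simp_all add: dist_commute)
  ultimately show False
    unfolding dist_real_def \<epsilon>_def by (simp add: abs_if split: if_splits)
qed

section \<open>Completing the square in one coordinate\<close>

text \<open>The map \<open>x \<mapsto> x + (u x - x \<bullet> b) *\<^sub>R b\<close>, which replaces the \<open>b\<close>-coordinate by \<open>u\<close>, is a local
  diffeomorphism; its inverse solves \<open>u = 0\<close> for the \<open>b\<close>-coordinate.\<close>

lemma implicit_shift:
  fixes u :: "'a::euclidean_space \<Rightarrow> real"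
  assumes "open T" "x0 \<in> T" and C: "Ck_on (Suc k) T u" and b: "b \<in> Basis"
    and u0: "u x0 = 0" and ub: "\<And>x. x \<in> T \<Longrightarrow> frechet_derivative u (at x) b \<noteq> 0"
  obtains r t where "r > 0" "ball x0 r \<subseteq> T" "t x0 = 0" "Ck_on (Suc k) (ball x0 r) t"
    "\<And>x s. x \<in> ball x0 r \<Longrightarrow> s \<in> {0..1} \<Longrightarrow> x - (s * t x) *\<^sub>R b \<in> T"
    "\<And>x. x \<in> ball x0 r \<Longrightarrow> u (x - t x *\<^sub>R b) = 0"
proof -
  let ?u = "\<lambda>c x. frechet_derivative u (at x) c"
  \<comment> \<open>These rank-one operators reduce the continuity of the operator-valued derivative
    of \<open>\<Psi>\<close> to that of the partial derivatives of \<open>u\<close>.\<close>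
  define K where "K c = blinfun_scaleR_left b o\<^sub>L blinfun_inner_left c" for c :: 'a
  have K: "blinfun_apply (K c) v = (v \<bullet> c) *\<^sub>R b" for c v
    by (simp add: K_def)
  define A where "A x = (\<Sum>c\<in>Basis. ?u c x *\<^sub>R K c)" for x
  have A: "blinfun_apply (A x) v = ?u v x *\<^sub>R b" if "x \<in> T" for x v
    using linear_real_expansion[OF has_derivative_linear[OF Ck_on_has_derivative[OF C that]], of v]
    by (simp add: A_def blinfun.sum_left blinfun.scaleR_left K scaleR_sum_left)
  define \<Psi> where "\<Psi> x = x + (u x - x \<bullet> b) *\<^sub>R b" for x
  define \<Psi>' where "\<Psi>' x = id_blinfun - K b + A x" for x
  have \<Psi>': "blinfun_apply (\<Psi>' x) v = v + (?u v x - v \<bullet> b) *\<^sub>R b" if "x \<in> T" for x v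
    using A[OF that] by (simp add: \<Psi>'_def blinfun.add_left blinfun.diff_left K algebra_simps)
  have der: "(\<Psi> has_derivative blinfun_apply (\<Psi>' x)) (at x)" if "x \<in> T" for x
  proof -
    have "(\<Psi> has_derivative (\<lambda>v. v + (?u v x - v \<bullet> b) *\<^sub>R b)) (at x)"
      unfolding \<Psi>_def
      by (auto intro!: derivative_eq_intros Ck_on_has_derivative[OF C that])
    then show ?thesis
      using \<Psi>'[OF that] by presburger
  qed
  have Cu: "Ck_on k T (?u c)" if "c \<in> Basis" for c
    using C that by simp
  have cont: "continuous_on T \<Psi>'"
    using Cu[THEN Ck_on_imp_continuous_on] unfolding \<Psi>'_def A_def
    by (intro continuous_on_add continuous_on_const continuous_on_sum continuous_on_scaleR)
  have lin: "linear (\<lambda>v. ?u v x)" if "x \<in> T" for x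
    using has_derivative_linear[OF Ck_on_has_derivative[OF C that]] .
  define a where "a = ?u b x0"
  have "a \<noteq> 0" using ub \<open>x0 \<in> T\<close> by (simp add: a_def)
  \<comment> \<open>Left inverse of \<open>\<Psi>' x0\<close>, found by solving for the
    \<open>b\<close>-coordinate; the division by \<open>a\<close> is where the non-vanishing of the
    derivative along \<open>b\<close> enters.\<close>
  define R where "R = id_blinfun + (1 / a) *\<^sub>R (K b - A x0)"
  have "R o\<^sub>L \<Psi>' x0 = id_blinfun"
  proof (rule blinfun_eqI)
    fix v
    let ?w = "v + (?u v x0 - v \<bullet> b) *\<^sub>R b"
    have 1: "?w \<bullet> b = ?u v x0"
      using b by (simp add: inner_add_left)
    have 2: "?u ?w x0 = ?u v x0 + (?u v x0 - v \<bullet> b) * a"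
      using lin[OF \<open>x0 \<in> T\<close>] by (simp add: linear_add linear_scale a_def)
    have "blinfun_apply (R o\<^sub>L \<Psi>' x0) v = ?w + (1 / a) *\<^sub>R ((?w \<bullet> b) *\<^sub>R b - ?u ?w x0 *\<^sub>R b)"
      using \<Psi>'[OF \<open>x0 \<in> T\<close>] A[OF \<open>x0 \<in> T\<close>]
      by (simp add: R_def blinfun.add_left blinfun.diff_left blinfun.scaleR_left K)
    also have "\<dots> = v + ((?u v x0 - v \<bullet> b) + (1 / a) * (?u v x0 - (?u v x0 + (?u v x0 - v \<bullet> b) * a))) *\<^sub>R b"
      unfolding 1 2 by (simp add: algebra_simps)
    also have "\<dots> = v"
      using \<open>a \<noteq> 0\<close> by (simp add: field_simps)
    finally show "blinfun_apply (R o\<^sub>L \<Psi>' x0) v = blinfun_apply id_blinfun v"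
      by simp
  qed
  from inverse_function_theorem[OF \<open>open T\<close> der cont \<open>x0 \<in> T\<close> this]
  obtain U V \<Gamma> \<Gamma>' where U: "open U" "U \<subseteq> T" "x0 \<in> U" and V: "open V" "\<Psi> x0 \<in> V"
    and hom: "homeomorphism U V \<Psi> \<Gamma>" and der\<Gamma>: "\<And>y. y \<in> V \<Longrightarrow> (\<Gamma> has_derivative \<Gamma>' y) (at y)"
    by metis
  \<comment> \<open>\<open>P\<close> puts 0 in the \<open>b\<close>-coordinate, where
    \<open>\<Psi>\<close> puts the value of \<open>u\<close>. So
    \<open>\<Psi> (\<Phi> x) = P x\<close> says that \<open>\<Phi> x\<close> is a zero of
    \<open>u\<close> differing from \<open>x\<close> along \<open>b\<close> only.\<close>
  define P where "P x = x - (x \<bullet> b) *\<^sub>R b" for x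
  have derP: "(P has_derivative P) (at x)" for x
    unfolding P_def by (auto intro!: derivative_eq_intros)
  have contP: "continuous_on X P" for X
    unfolding P_def by (intro continuous_on_diff continuous_on_scaleR continuous_on_inner
        continuous_on_id continuous_on_const)
  define \<Phi> where "\<Phi> x = \<Gamma> (P x)" for x
  have P0: "P x0 = \<Psi> x0" by (simp add: P_def \<Psi>_def u0)
  then have \<Phi>0: "\<Phi> x0 = x0"
    using hom U by (simp add: \<Phi>_def homeomorphism_apply1)
  have openPV: "open (P -` V)"
    using contP[of UNIV] V(1) by (simp add: open_vimage continuous_on_eq_continuous_at)
  have der\<Phi>: "(\<Phi> has_derivative (\<lambda>v. \<Gamma>' (P x) (P v))) (at x)" if "P x \<in> V" for x
    unfolding \<Phi>_def using has_derivative_compose[OF derP der\<Gamma>[OF that]] .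
  have "continuous_on (P -` V) \<Phi>"
    using der\<Phi> by (auto intro!: continuous_at_imp_continuous_on has_derivative_continuous)
  \<comment> \<open>Both \<open>x\<close> and \<open>\<Phi> x\<close> will be confined to this ball,
    whose convexity keeps the segment between them in \<open>T\<close>.\<close>
  obtain e where e: "e > 0" "ball x0 e \<subseteq> T"
    using \<open>open T\<close> \<open>x0 \<in> T\<close> openE by blast
  have "open ((P -` V) \<inter> \<Phi> -` (ball x0 e))"
    using continuous_open_preimage[OF \<open>continuous_on (P -` V) \<Phi>\<close> openPV open_ball] .
  then have "open ((P -` V) \<inter> \<Phi> -` (ball x0 e) \<inter> ball x0 e)" by auto
  moreover have "x0 \<in> (P -` V) \<inter> \<Phi> -` (ball x0 e) \<inter> ball x0 e"
    using P0 V \<Phi>0 e by simp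
  ultimately obtain r where r: "r > 0" "ball x0 r \<subseteq> (P -` V) \<inter> \<Phi> -` (ball x0 e) \<inter> ball x0 e"
    using openE by blast
  define t where "t x = (x - \<Phi> x) \<bullet> b" for x
  have \<Psi>\<Phi>: "\<Psi> (\<Phi> x) = P x" if "x \<in> ball x0 r" for x
    using that r hom by (auto simp: \<Phi>_def homeomorphism_apply2)
  have u\<Phi>: "u (\<Phi> x) = 0" if "x \<in> ball x0 r" for x
  proof -
    have "\<Psi> (\<Phi> x) \<bullet> b = u (\<Phi> x)" "P x \<bullet> b = 0"
      using b by (simp_all add: \<Psi>_def P_def inner_add_left inner_diff_left)
    then show ?thesis using \<Psi>\<Phi>[OF that] by simp
  qed
  have \<Phi>t: "\<Phi> x = x - t x *\<^sub>R b" if "x \<in> ball x0 r" for x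
    using \<Psi>\<Phi>[OF that] u\<Phi>[OF that] by (simp add: \<Psi>_def P_def t_def algebra_simps)
  have seg: "x - (s * t x) *\<^sub>R b \<in> T" if x: "x \<in> ball x0 r" and s: "s \<in> {0..1}" for x s
  proof -
    have "x - t x *\<^sub>R b \<in> ball x0 e" "x \<in> ball x0 e"
      using r x \<Phi>t[OF x] by auto
    then have "(1 - s) *\<^sub>R x + s *\<^sub>R (x - t x *\<^sub>R b) \<in> ball x0 e"
      using s convex_ball[of x0 e] by (intro convexD) auto
    moreover have "(1 - s) *\<^sub>R x + s *\<^sub>R (x - t x *\<^sub>R b) = x - (s * t x) *\<^sub>R b"
      by (simp add: algebra_simps)
    ultimately show ?thesis using e by auto
  qed
  then have seg1: "x - t x *\<^sub>R b \<in> T" if "x \<in> ball x0 r" for x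
    using that[THEN seg, of 1] by simp
  have ut: "u (x - t x *\<^sub>R b) = 0" if "x \<in> ball x0 r" for x
    using u\<Phi>[OF that] \<Phi>t[OF that] by simp
  \<comment> \<open>The inverse function theorem is used for bare differentiability of
    \<open>t\<close>; the value of the derivative comes from differentiating the identity
    \<open>ut\<close>.\<close>
  have dert: "(t has_derivative (\<lambda>v. ?u v (x - t x *\<^sub>R b) / ?u b (x - t x *\<^sub>R b))) (at x)"
    if x: "x \<in> ball x0 r" for x
  proof -
    have "P x \<in> V" using r x by auto
    then have "(t has_derivative (\<lambda>v. (v - \<Gamma>' (P x) (P v)) \<bullet> b)) (at x)"
      unfolding t_def
      by (intro has_derivative_inner_left has_derivative_diff has_derivative_ident der\<Phi>)
    then obtain t' where t': "(t has_derivative t') (at x)"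
      by blast
    have "((\<lambda>x. u (x - (1 * t x) *\<^sub>R b)) has_derivative
        (\<lambda>v. ?u v (x - (1 * t x) *\<^sub>R b) - 1 * t' v * ?u b (x - (1 * t x) *\<^sub>R b))) (at x)"
      using seg1[OF x] by (intro has_derivative_compose_shift t' Ck_on_has_derivative[OF C]) simp
    moreover have "((\<lambda>x. u (x - (1 * t x) *\<^sub>R b)) has_derivative (\<lambda>v. 0)) (at x)"
      by (rule has_derivative_transform_within_open[OF has_derivative_const[of 0] open_ball x])
        (simp add: ut)
    ultimately have eq: "(\<lambda>v. ?u v (x - (1 * t x) *\<^sub>R b) - 1 * t' v * ?u b (x - (1 * t x) *\<^sub>R b)) = (\<lambda>v. 0)"
      by (rule has_derivative_unique)
    have "t' v = ?u v (x - t x *\<^sub>R b) / ?u b (x - t x *\<^sub>R b)" for v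
      using fun_cong[OF eq, of v] ub[OF seg1[OF x]] by (simp add: nonzero_eq_divide_eq)
    then show ?thesis using t' by presburger
  qed
  \<comment> \<open>Bootstrap: \<open>dert\<close> expresses the derivative of \<open>t\<close>
    through \<open>t\<close> and partial derivatives of \<open>u\<close>, so \<open>t\<close> gains
    one order at a time until the regularity of \<open>u\<close> is reached.\<close>
  have "j \<le> Suc k \<Longrightarrow> Ck_on j (ball x0 r) t" for j
  proof (induction j)
    case 0
    show ?case
      by (simp, intro continuous_at_imp_continuous_on ballI has_derivative_continuous[OF dert])
  next
    case (Suc j)
    then have j: "Ck_on j (ball x0 r) t" "j \<le> k" by auto
    have "Ck_on j (ball x0 r) (\<lambda>x. ?u c (x - t x *\<^sub>R b))" if "c \<in> Basis" for c
      using Ck_on_le[OF Cu[OF that] j(2)] j(1) seg1 b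
      by (intro Ck_on_compose_shift[where T = T]) auto
    then have quot: "Ck_on j (ball x0 r) (\<lambda>x. ?u c (x - t x *\<^sub>R b) / ?u b (x - t x *\<^sub>R b))"
      if "c \<in> Basis" for c
      using that b ub[OF seg1] by (intro Ck_on_divide open_ball) blast+
    show ?case
      by (rule Ck_on_SucI[OF open_ball dert quot])
  qed
  then have "Ck_on (Suc k) (ball x0 r) t" by blast
  moreover have "ball x0 r \<subseteq> T" using r e by blast
  moreover have "t x0 = 0" by (simp add: t_def \<Phi>0)
  ultimately show ?thesis
    using r(1) seg ut by (intro that[of r t])
qed


lemma nonneg_zero_imp_critical:
  assumes "open W" "Ck_on (Suc k) W g" "\<And>x. x \<in> W \<Longrightarrow> g x \<ge> 0" "x \<in> W" "g x = 0"
  shows "frechet_derivative g (at x) v = 0"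
  using differential_zero_maxmin[OF assms(4,1) Ck_on_has_derivative[OF assms(2,4)]] assms(3,5)
  by (simp add: fun_eq_iff)

lemma Ck_on_second_deriv:
  assumes "Ck_on (Suc (Suc m)) W g" "b \<in> Basis" "c \<in> Basis"
  shows "Ck_on m W (\<lambda>x. second_deriv g x b c)"
  using assms by (simp add: second_deriv_def)

lemma second_deriv_has_derivative:
  assumes "Ck_on (Suc (Suc m)) W g" "b \<in> Basis" "x \<in> W"
  shows "((\<lambda>y. frechet_derivative g (at y) b) has_derivative second_deriv g x b) (at x)"
proof -
  have "Ck_on (Suc m) W (\<lambda>y. frechet_derivative g (at y) b)"
    using assms(1,2) by (simp only: Ck_on.simps) blast
  from Ck_on_has_derivative[OF this assms(3)] show ?thesis
    unfolding second_deriv_def .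
qed

text \<open>One step of completing the square: \<open>h\<close> is the minimum of \<open>g\<close> over the \<open>b\<close>-coordinate,
  attained at \<open>x - t x *\<^sub>R b\<close>. There \<open>\<nabla>h = \<nabla>g\<close>, so \<open>h\<close> loses no derivative although \<open>t\<close> does,
  and its Hessian is the Schur complement of the \<open>(b, b)\<close> entry.\<close>

lemma eliminate_coordinate:
  fixes g :: "'a::euclidean_space \<Rightarrow> real"
  assumes W: "open W" "x0 \<in> W" and C: "Ck_on (Suc (Suc m)) W g"
    and nonneg: "\<And>x. x \<in> W \<Longrightarrow> g x \<ge> 0" and g0: "g x0 = 0" and b: "b \<in> Basis"
    and pos: "second_deriv g x0 b b > 0"
  obtains r h F where "r > 0" "ball x0 r \<subseteq> W"
    "Ck_on (Suc (Suc m)) (ball x0 r) h" "Ck_on m (ball x0 r) F"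
    "\<And>x. x \<in> ball x0 r \<Longrightarrow> g x = h x + (F x)\<^sup>2"
    "\<And>x. x \<in> ball x0 r \<Longrightarrow> h x \<ge> 0" "h x0 = 0"
    "\<And>x. x \<in> ball x0 r \<Longrightarrow> frechet_derivative h (at x) b = 0"
    "\<And>c x. \<forall>y\<in>W. frechet_derivative g (at y) c = 0 \<Longrightarrow> x \<in> ball x0 r \<Longrightarrow>
        frechet_derivative h (at x) c = 0"
    "\<And>c v. c \<in> Basis \<Longrightarrow> second_deriv h x0 c v = second_deriv g x0 c v -
        second_deriv g x0 b v / second_deriv g x0 b b * second_deriv g x0 c b"
proof -
  define \<beta> where "\<beta> = second_deriv g x0 b b"
  have "\<beta> > 0" using pos by (simp add: \<beta>_def)
  let ?g = "\<lambda>c x. frechet_derivative g (at x) c"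
  have C1: "Ck_on (Suc m) W (?g c)" if "c \<in> Basis" for c
    using C that by (simp only: Ck_on.simps) blast
  have C2: "Ck_on m W (\<lambda>x. second_deriv g x b b)"
    using Ck_on_second_deriv[OF C b b] .
  \<comment> \<open>The bound serves twice: it makes the implicit equation solvable and keeps the
    Taylor remainder \<open>q\<close> positive, so that its root is smooth.\<close>
  define T where "T = W \<inter> (\<lambda>x. second_deriv g x b b) -` {\<beta> / 2<..}"
  have T: "open T" "x0 \<in> T" "T \<subseteq> W"
    using continuous_open_preimage[OF Ck_on_imp_continuous_on[OF C2] W(1), of "{\<beta> / 2<..}"] W pos
    by (auto simp: T_def \<beta>_def)
  have sdT: "second_deriv g x b b > \<beta> / 2" if "x \<in> T" for x
    using that by (simp add: T_def)
  have sd_ne: "frechet_derivative (?g b) (at x) b \<noteq> 0" if "x \<in> T" for x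
    using sdT[OF that] \<open>\<beta> > 0\<close> by (simp add: second_deriv_def)
  obtain r t where r: "r > 0" "ball x0 r \<subseteq> T" and t0: "t x0 = 0"
    and Ct: "Ck_on (Suc m) (ball x0 r) t"
    and seg: "\<And>x s. x \<in> ball x0 r \<Longrightarrow> s \<in> {0..1} \<Longrightarrow> x - (s * t x) *\<^sub>R b \<in> T"
    and crit: "\<And>x. x \<in> ball x0 r \<Longrightarrow> ?g b (x - t x *\<^sub>R b) = 0"
    by (rule implicit_shift[OF T(1,2) Ck_on_subset[OF C1[OF b] T(3)] b
          nonneg_zero_imp_critical[OF W(1) C nonneg W(2) g0] sd_ne])
      (assumption, assumption, rule that)
  let ?B = "ball x0 r"
  have seg1: "x - t x *\<^sub>R b \<in> W" if "x \<in> ?B" for x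
    using seg[OF that, of 1] T(3) by auto
  have tder: "(t has_derivative frechet_derivative t (at x)) (at x)" if "x \<in> ?B" for x
    using Ck_on_has_derivative[OF Ct that] .
  define h where "h x = g (x - t x *\<^sub>R b)" for x
  \<comment> \<open>The chain rule term with the derivative of \<open>t\<close> carries the factor
    \<open>?g b (x - t x *\<^sub>R b)\<close>, which is zero by \<open>crit\<close>.\<close>
  have hder: "(h has_derivative (\<lambda>v. ?g v (x - t x *\<^sub>R b))) (at x)" if "x \<in> ?B" for x
    using has_derivative_compose_shift[OF tder[OF that], of g "\<lambda>v. ?g v (x - t x *\<^sub>R b)" 1 b] crit[OF that]
      Ck_on_has_derivative[OF C seg1[OF that]]
    unfolding h_def by simp
  have Dh: "frechet_derivative h (at x) c = ?g c (x - t x *\<^sub>R b)" if "x \<in> ?B" for x c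
    by (simp flip: frechet_derivative_at[OF hder[OF that]])
  have Cgt: "Ck_on (Suc m) ?B (\<lambda>x. ?g c (x - t x *\<^sub>R b))" if "c \<in> Basis" for c
    by (rule Ck_on_compose_shift[OF open_ball b C1[OF that] Ct seg1])
  have Ch: "Ck_on (Suc (Suc m)) ?B h"
    by (rule Ck_on_SucI[OF open_ball hder Cgt])
  have x0B: "x0 \<in> ?B" using r by simp
  have sd: "second_deriv h x0 c v
      = second_deriv g x0 c v - frechet_derivative t (at x0) v * second_deriv g x0 c b"
    if c: "c \<in> Basis" for c v
  proof -
    have "((\<lambda>x. ?g c (x - (1 * t x) *\<^sub>R b)) has_derivative
       (\<lambda>v. second_deriv g x0 c v - 1 * frechet_derivative t (at x0) v * second_deriv g x0 c b)) (at x0)"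
      using second_deriv_has_derivative[OF C c W(2)] t0
      by (intro has_derivative_compose_shift tder x0B) simp
    then have "((\<lambda>y. frechet_derivative h (at y) c) has_derivative
       (\<lambda>v. second_deriv g x0 c v - 1 * frechet_derivative t (at x0) v * second_deriv g x0 c b)) (at x0)"
      by (rule has_derivative_transform_within_open[OF _ open_ball x0B]) (simp add: Dh)
    from frechet_derivative_at[OF this, symmetric] show ?thesis
      by (simp add: second_deriv_def[of h])
  qed
  have hb: "frechet_derivative h (at x) b = 0" if "x \<in> ?B" for x
    using Dh[OF that] crit[OF that] by simp
  have "second_deriv h x0 b v = 0" for v
  proof -
    have "((\<lambda>y. frechet_derivative h (at y) b) has_derivative (\<lambda>v. 0)) (at x0)"
      by (rule has_derivative_transform_within_open[OF has_derivative_const[of 0] open_ball x0B])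
        (simp add: hb)
    from frechet_derivative_at[OF this, symmetric] show ?thesis
      by (simp add: second_deriv_def)
  qed
  \<comment> \<open>Row \<open>b\<close> of the Hessian of \<open>h\<close> vanishes, so
    \<open>sd\<close> with \<open>c = b\<close> can be solved for the derivative of
    \<open>t\<close>.\<close>
  then have t': "frechet_derivative t (at x0) v = second_deriv g x0 b v / second_deriv g x0 b b" for v
    using sd[OF b, of v] pos by (simp add: nonzero_eq_divide_eq)
  \<comment> \<open>Integral Taylor remainder around the minimum. The usual weight
    \<open>1 - s\<close> becomes \<open>s\<close> because the segment is run from \<open>x\<close>
    at \<open>s = 0\<close> to the minimum at \<open>s = 1\<close>.\<close>
  define q where "q x = integral {0..1} (\<lambda>s. s * second_deriv g (x - (s * t x) *\<^sub>R b) b b)" for x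
  have Ctm: "Ck_on m ?B t"
    using Ck_on_Suc_imp[OF Ct] .
  have Cq: "Ck_on m ?B q"
    unfolding q_def
    by (rule Ck_on_integral_shift[OF open_ball b Ck_on_subset[OF C2 T(3)] Ctm continuous_on_id seg])
  have cont_sd: "continuous_on (?B \<times> {0..1}) (\<lambda>(x, s). s * second_deriv g (x - (s * t x) *\<^sub>R b) b b)"
    by (rule continuous_on_weighted_shift[OF Ck_on_imp_continuous_on[OF Ck_on_subset[OF C2 T(3)]]
          Ck_on_imp_continuous_on[OF Ct] continuous_on_id seg])
  have int: "(\<lambda>s. s * second_deriv g (x - (s * t x) *\<^sub>R b) b b) integrable_on {0..1}" if "x \<in> ?B" for x
    using continuous_on_Pair_section[OF cont_sd that] by (simp add: integrable_continuous_real)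
  have qpos: "q x > 0" if x: "x \<in> ?B" for x
  proof -
    have "((\<lambda>s::real. s * (\<beta> / 2)) has_integral (1\<^sup>2 - 0\<^sup>2) / 2 * (\<beta> / 2)) {0..1}"
      by (intro has_integral_mult_left ident_has_integral) simp
    then have I: "((\<lambda>s::real. s * (\<beta> / 2)) has_integral \<beta> / 4) {0..1}"
      by simp
    have "\<beta> / 4 \<le> q x"
      unfolding q_def
    proof (rule has_integral_le[OF I integrable_integral[OF int[OF x]]])
      fix s :: real assume s: "s \<in> {0..1}"
      show "s * (\<beta> / 2) \<le> s * second_deriv g (x - (s * t x) *\<^sub>R b) b b"
        using sdT[OF seg[OF x s]] s by (intro mult_left_mono) auto
    qed
    then show ?thesis using \<open>\<beta> > 0\<close> by simp
  qed
  have gq: "g x = h x + (t x)\<^sup>2 * q x" if x: "x \<in> ?B" for x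
  proof -
    define v where "v = (- t x) *\<^sub>R b"
    have v: "x + s *\<^sub>R v = x - (s * t x) *\<^sub>R b" for s
      by (simp add: v_def)
    define G where "G s = g (x + s *\<^sub>R v)" for s
    define G1 where "G1 s = (- t x) * ?g b (x + s *\<^sub>R v)" for s
    define G2 where "G2 s = (t x)\<^sup>2 * second_deriv g (x + s *\<^sub>R v) b b" for s
    have inW: "x + s *\<^sub>R v \<in> W" if "s \<in> {0..1}" for s
      using seg[OF x that] T(3) v by auto
    have dG: "(G has_real_derivative G1 s) (at s)" if "s \<in> {0..1}" for s
    proof -
      have "?g v (x + s *\<^sub>R v) = G1 s"
        using linear_scale[OF has_derivative_linear[OF Ck_on_has_derivative[OF C inW[OF that]]], of "- t x" b]
        by (simp add: v_def G1_def)
      then show ?thesis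
        using has_real_derivative_along_line[OF C inW[OF that]] by (simp add: G_def[abs_def])
    qed
    have dG1: "(G1 has_real_derivative G2 s) (at s)" if "s \<in> {0..1}" for s
    proof -
      have "frechet_derivative (?g b) (at (x + s *\<^sub>R v)) v = (- t x) * second_deriv g (x + s *\<^sub>R v) b b"
        using linear_scale[OF has_derivative_linear[OF Ck_on_has_derivative[OF C1[OF b] inW[OF that]]], of "- t x" b]
        by (simp add: v_def second_deriv_def)
      then have "((\<lambda>s. ?g b (x + s *\<^sub>R v)) has_real_derivative (- t x) * second_deriv g (x + s *\<^sub>R v) b b) (at s)"
        using has_real_derivative_along_line[OF C1[OF b] inW[OF that]] by simp
      from DERIV_cmult[OF this, of "- t x"] show ?thesis
        by (simp add: G1_def[abs_def] G2_def power2_eq_square mult.assoc)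
    qed
    \<comment> \<open>Integration by parts; \<open>G1 1 = 0\<close> at the critical point, which
      leaves \<open>G 0 - G 1 = g x - h x\<close>.\<close>
    have "((\<lambda>s. s * G1 s - G s) has_real_derivative s * G2 s) (at s)" if "s \<in> {0..1}" for s
      using dG[OF that] dG1[OF that] by (auto intro!: derivative_eq_intros)
    then have "((\<lambda>s. s * G2 s) has_integral (1 * G1 1 - G 1) - (0 * G1 0 - G 0)) {0..1}"
      by (intro fundamental_theorem_of_calculus)
        (auto simp: has_real_derivative_iff_has_vector_derivative[symmetric] intro: DERIV_subset)
    then have "integral {0..1} (\<lambda>s. s * G2 s) = G1 1 - G 1 + G 0"
      by (simp add: integral_unique)
    moreover have "integral {0..1} (\<lambda>s. s * G2 s) = (t x)\<^sup>2 * q x"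
    proof -
      have "(\<lambda>s. s * G2 s) = (\<lambda>s. (t x)\<^sup>2 * (s * second_deriv g (x - (s * t x) *\<^sub>R b) b b))"
        by (simp add: G2_def v fun_eq_iff)
      then show ?thesis
        by (simp add: q_def)
    qed
    moreover have "G1 1 = 0" "G 1 = h x" "G 0 = g x"
      using crit[OF x] by (simp_all add: G1_def G_def h_def v_def)
    ultimately show ?thesis by simp
  qed
  \<comment> \<open>The loss of two derivatives in the theorem occurs here: \<open>q\<close>
    contains second derivatives of \<open>g\<close>.\<close>
  define F where "F x = t x * sqrt (q x)" for x
  have CF: "Ck_on m ?B F"
    unfolding F_def by (intro Ck_on_mult Ck_on_sqrt open_ball Ctm Cq qpos)
  have gF: "g x = h x + (F x)\<^sup>2" if "x \<in> ?B" for x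
    using gq[OF that] qpos[OF that] by (simp add: F_def power_mult_distrib)
  show ?thesis
  proof (rule that[OF r(1) _ Ch CF gF])
    show "?B \<subseteq> W" using r T by blast
    show "h x \<ge> 0" if "x \<in> ?B" for x
      using nonneg[OF seg1[OF that]] by (simp add: h_def)
    show "h x0 = 0" by (simp add: h_def t0 g0)
    show "frechet_derivative h (at x) c = 0"
      if "\<forall>y\<in>W. ?g c y = 0" "x \<in> ?B" for c x
      using Dh[OF that(2)] that(1) seg1[OF that(2)] by simp
    show "second_deriv h x0 c v = second_deriv g x0 c v -
        second_deriv g x0 b v / second_deriv g x0 b b * second_deriv g x0 c b" if "c \<in> Basis" for c v
      using sd[OF that] t' by simp
  qed (use hb in auto)
qed

section \<open>The Hessian at a zero\<close>

lemma hessian_inner_Basis: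
  assumes "b \<in> Basis"
  shows "hessian g x v \<bullet> b = second_deriv g x b v"
proof -
  have "hessian g x v \<bullet> b = (\<Sum>c\<in>Basis. if c = b then second_deriv g x c v else 0)"
    unfolding hessian_def inner_sum_left
    by (intro sum.cong) (auto simp: inner_Basis assms)
  then show ?thesis
    using assms by simp
qed

lemma hessian_eq_0_iff: "hessian g x v = 0 \<longleftrightarrow> (\<forall>b\<in>Basis. second_deriv g x b v = 0)"
  by (auto simp: euclidean_eq_iff[of "hessian g x v"] hessian_inner_Basis)

lemma linear_second_deriv:
  assumes "Ck_on (Suc (Suc m)) W g" "x \<in> W" "b \<in> Basis"
  shows "linear (second_deriv g x b)"
  using has_derivative_linear[OF second_deriv_has_derivative[OF assms(1,3,2)]] .

lemma linear_hessian:
  assumes "Ck_on (Suc (Suc m)) W g" "x \<in> W"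
  shows "linear (hessian g x)"
proof
  note lin = linear_second_deriv[OF assms]
  show "hessian g x (v + w) = hessian g x v + hessian g x w" for v w
    by (auto simp: euclidean_eq_iff[where 'a = 'a] inner_add_left hessian_inner_Basis linear_add[OF lin])
  show "hessian g x (k *\<^sub>R v) = k *\<^sub>R hessian g x v" for k v
    by (auto simp: euclidean_eq_iff[where 'a = 'a] hessian_inner_Basis linear_scale[OF lin])
qed

text \<open>A negative second derivative along \<open>v\<close> would make the first derivative
  \<open>\<phi>\<close>, zero at the start, negative just afterwards, and the mean value theorem
  would push \<open>g\<close> below 0.\<close>

lemma hessian_nonneg_at_zero:
  assumes W: "open W" "x0 \<in> W" and C: "Ck_on (Suc (Suc m)) W g"
    and nonneg: "\<And>x. x \<in> W \<Longrightarrow> g x \<ge> 0" and g0: "g x0 = 0"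
  shows "v \<bullet> hessian g x0 v \<ge> 0"
proof (rule ccontr)
  assume neg: "\<not> v \<bullet> hessian g x0 v \<ge> 0"
  let ?g = "\<lambda>c x. frechet_derivative g (at x) c"
  have C1: "Ck_on (Suc m) W (?g c)" if "c \<in> Basis" for c
    using C that by (simp only: Ck_on.simps) blast
  define \<phi> where "\<phi> s = (\<Sum>c\<in>Basis. (v \<bullet> c) * ?g c (x0 + s *\<^sub>R v))" for s
  have "(\<phi> has_real_derivative (\<Sum>c\<in>Basis. (v \<bullet> c) * second_deriv g x0 c v)) (at 0)"
    unfolding \<phi>_def
  proof (intro DERIV_sum DERIV_cmult)
    fix c :: 'a assume c: "c \<in> Basis"
    show "((\<lambda>s. ?g c (x0 + s *\<^sub>R v)) has_real_derivative second_deriv g x0 c v) (at 0)"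
      using has_real_derivative_along_line[OF C1[OF c], of x0 0 v] W by (simp add: second_deriv_def)
  qed
  moreover have "(\<Sum>c\<in>Basis. (v \<bullet> c) * second_deriv g x0 c v) = v \<bullet> hessian g x0 v"
    unfolding euclidean_inner[of v "hessian g x0 v"] by (simp add: hessian_inner_Basis)
  ultimately have "(\<phi> has_real_derivative v \<bullet> hessian g x0 v) (at 0)"
    by simp
  from DERIV_neg_dec_right[OF this] neg
  obtain d where d: "d > 0" "\<forall>s>0. s < d \<longrightarrow> \<phi> (0 + s) < \<phi> 0"
    by (meson not_le)
  have "\<phi> 0 = 0"
    using nonneg_zero_imp_critical[OF W(1) C nonneg W(2) g0] by (simp add: \<phi>_def)
  have "open ((\<lambda>s. x0 + s *\<^sub>R v) -` W)"
    using W(1) by (intro open_vimage continuous_on_add continuous_on_scaleR continuous_on_id continuous_on_const)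
  moreover have "0 \<in> (\<lambda>s. x0 + s *\<^sub>R v) -` W"
    using W(2) by simp
  ultimately obtain e where e: "e > 0" "ball 0 e \<subseteq> (\<lambda>s. x0 + s *\<^sub>R v) -` W"
    using openE by blast
  define s where "s = min d e / 2"
  have s: "0 < s" "s < d" "s < e"
    using d(1) e(1) by (auto simp: s_def)
  have inW: "x0 + j *\<^sub>R v \<in> W" if "0 \<le> j" "j \<le> s" for j
    using that s e(2) by (auto simp: subset_iff)
  have "((\<lambda>s. g (x0 + s *\<^sub>R v)) has_real_derivative \<phi> j) (at j)" if "0 \<le> j" "j \<le> s" for j
  proof -
    have "\<phi> j = ?g v (x0 + j *\<^sub>R v)"
      using linear_real_expansion[OF has_derivative_linear[OF Ck_on_has_derivative[OF C inW[OF that]]], of v]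
      by (simp add: \<phi>_def mult.commute)
    then show ?thesis
      using has_real_derivative_along_line[OF C inW[OF that]] by simp
  qed
  from MVT2[OF s(1) this] obtain j where j: "0 < j" "j < s"
    "g (x0 + s *\<^sub>R v) - g (x0 + 0 *\<^sub>R v) = (s - 0) * \<phi> j"
    by blast
  have "\<phi> j < 0" using d(2) j s \<open>\<phi> 0 = 0\<close> by simp
  then have "g (x0 + s *\<^sub>R v) < 0"
    using j(3) s(1) g0 by (simp add: mult_pos_neg)
  moreover have "g (x0 + s *\<^sub>R v) \<ge> 0"
    using s by (intro nonneg inW) simp_all
  ultimately show False by simp
qed

text \<open>Supplies the pivot of an elimination step. Without one, semidefiniteness forces the
  diagonal to vanish, and then the whole matrix.\<close>

lemma hessian_diagonal_pos:
  assumes W: "open W" "x0 \<in> W" and C: "Ck_on (Suc (Suc m)) W g"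
    and nonneg: "\<And>x. x \<in> W \<Longrightarrow> g x \<ge> 0" and g0: "g x0 = 0" and ne: "hessian g x0 v \<noteq> 0"
  obtains b where "b \<in> Basis" "second_deriv g x0 b b > 0"
proof (rule ccontr)
  note witness = that
  assume "\<not> thesis"
  then have le: "second_deriv g x0 b b \<le> 0" if "b \<in> Basis" for b
    using witness[OF that] by linarith
  note H = hessian_nonneg_at_zero[OF W C nonneg g0]
  have C2: "Ck_on 2 W g"
    using Ck_on_le[OF C, of 2] by simp
  have lin: "linear (hessian g x0)"
    using linear_hessian[OF C W(2)] .
  have diag: "second_deriv g x0 b b = 0" if "b \<in> Basis" for b
    using H[of b] le[OF that] hessian_inner_Basis[OF that, of g x0 b] by (simp add: inner_commute)
  have "second_deriv g x0 b c = 0" if b: "b \<in> Basis" and c: "c \<in> Basis" for b c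
  proof -
    have eq: "second_deriv g x0 b c = second_deriv g x0 c b"
      using second_deriv_commute[OF C2 W b c] .
    have inn: "b \<bullet> hessian g x0 b = 0" "c \<bullet> hessian g x0 c = 0"
      "b \<bullet> hessian g x0 c = second_deriv g x0 b c" "c \<bullet> hessian g x0 b = second_deriv g x0 b c"
      using b c diag eq by (simp_all add: inner_commute[of _ "hessian g x0 _"] hessian_inner_Basis)
    \<comment> \<open>The quadratic form at \<open>b + c\<close> and at \<open>b - c\<close> equals
      plus and minus twice the off-diagonal entry.\<close>
    show ?thesis
      using H[of "b + c"] H[of "b - c"] inn
      by (simp add: linear_add[OF lin] linear_diff[OF lin] inner_add_left inner_add_right
          inner_diff_left inner_diff_right)
  qed
  then have "second_deriv g x0 b v = 0" if "b \<in> Basis" for b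
    using linear_real_expansion[OF linear_second_deriv[OF C W(2) that], of v] that by simp
  then show False
    using ne by (simp add: hessian_eq_0_iff)
qed

lemma mem_span_Basis_subset:
  assumes "S \<subseteq> Basis" "\<And>b. b \<in> Basis - S \<Longrightarrow> w \<bullet> b = 0"
  shows "w \<in> span S"
proof -
  have "w = (\<Sum>b\<in>Basis. (w \<bullet> b) *\<^sub>R b)"
    by (simp add: euclidean_representation)
  also have "\<dots> = (\<Sum>b\<in>S. (w \<bullet> b) *\<^sub>R b)"
    using assms by (intro sum.mono_neutral_right) auto
  also have "\<dots> \<in> span S"
    by (intro span_sum span_scale span_base)
  finally show ?thesis .
qed

text \<open>Carries the vanishing of the remainder from points of the manifold to points reached
  along eliminated coordinates; convexity keeps the connecting segment in \<open>W\<close>.\<close>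

lemma constant_along_span:
  assumes C: "Ck_on (Suc m) W h" and "convex W" "x \<in> W" "z \<in> W" "x - z \<in> span S"
    and zero: "\<And>b y. b \<in> S \<Longrightarrow> y \<in> W \<Longrightarrow> frechet_derivative h (at y) b = 0"
  shows "h x = h z"
proof -
  have inW: "z + s *\<^sub>R (x - z) \<in> W" if "0 \<le> s" "s \<le> 1" for s
  proof -
    have "(1 - s) *\<^sub>R z + s *\<^sub>R x \<in> W"
      using assms that by (intro convexD) auto
    then show ?thesis by (simp add: algebra_simps)
  qed
  have "((\<lambda>s. h (z + s *\<^sub>R (x - z))) has_real_derivative 0) (at s)" if "0 \<le> s" "s \<le> 1" for s
  proof -
    have "frechet_derivative h (at (z + s *\<^sub>R (x - z))) (x - z) = 0"
      using linear_eq_0_on_span[OF has_derivative_linear[OF Ck_on_has_derivative[OF C inW[OF that]]]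
          zero assms(5)] inW[OF that] by blast
    then show ?thesis
      using has_real_derivative_along_line[OF C inW[OF that]] by simp
  qed
  from MVT2[of 0 1, OF _ this] show ?thesis by auto
qed

section \<open>Local sums of squares\<close>

text \<open>State of the elimination after the coordinates in \<open>S\<close> have been used up: \<open>h\<close> no longer depends
  on them, and the Hessian conditions record that Gaussian elimination has lowered the rank by at most
  \<open>card S\<close> while the kernel of the Hessian of \<open>f\<close> stays transversal to \<open>span S\<close>.\<close>

definition square_reduction ::
  "nat \<Rightarrow> ('a::euclidean_space \<Rightarrow> real) \<Rightarrow> 'a \<Rightarrow> 'a set \<Rightarrow> real \<Rightarrow> ('a \<Rightarrow> real) \<Rightarrow> ('a \<Rightarrow> 'a \<Rightarrow> real) \<Rightarrow> bool"
  where "square_reduction m f x0 S r h F \<longleftrightarrow>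
    S \<subseteq> Basis \<and> r > 0 \<and> Ck_on (Suc (Suc m)) (ball x0 r) h \<and>
    (\<forall>x\<in>ball x0 r. h x \<ge> 0) \<and> h x0 = 0 \<and>
    (\<forall>b\<in>S. \<forall>x\<in>ball x0 r. frechet_derivative h (at x) b = 0) \<and>
    (\<forall>b\<in>S. Ck_on m (ball x0 r) (F b)) \<and>
    (\<forall>x\<in>ball x0 r. f x = h x + (\<Sum>b\<in>S. (F b x)\<^sup>2)) \<and>
    (\<forall>v. hessian f x0 v = 0 \<longrightarrow> hessian h x0 v = 0) \<and>
    (\<forall>v\<in>span S. hessian f x0 v = 0 \<longrightarrow> v = 0) \<and>
    hessian_rank f x0 \<le> hessian_rank h x0 + card S"

text \<open>A positive diagonal entry of the remainder's Hessian is the pivot. It lies outside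
  \<open>S\<close> because the rows belonging to \<open>S\<close> vanish.\<close>

lemma square_reduction_step:
  fixes f :: "'a::euclidean_space \<Rightarrow> real"
  assumes red: "square_reduction m f x0 S r h F" and ne: "hessian h x0 w \<noteq> 0"
  obtains b r' h' F' where "b \<in> Basis - S" "r' \<le> r" "square_reduction m f x0 (insert b S) r' h' F'"
proof -
  let ?W = "ball x0 r"
  have S: "S \<subseteq> Basis" and r: "r > 0" and C: "Ck_on (Suc (Suc m)) ?W h"
    and nonneg: "\<And>x. x \<in> ?W \<Longrightarrow> h x \<ge> 0" and h0: "h x0 = 0"
    and hS: "\<And>b x. b \<in> S \<Longrightarrow> x \<in> ?W \<Longrightarrow> frechet_derivative h (at x) b = 0"
    and CF: "\<And>b. b \<in> S \<Longrightarrow> Ck_on m ?W (F b)"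
    and f: "\<And>x. x \<in> ?W \<Longrightarrow> f x = h x + (\<Sum>b\<in>S. (F b x)\<^sup>2)"
    and ker: "\<And>v. hessian f x0 v = 0 \<Longrightarrow> hessian h x0 v = 0"
    and trans: "\<And>v. v \<in> span S \<Longrightarrow> hessian f x0 v = 0 \<Longrightarrow> v = 0"
    and rank: "hessian_rank f x0 \<le> hessian_rank h x0 + card S"
    using red unfolding square_reduction_def by blast+
  have x0: "x0 \<in> ?W" using r by simp
  obtain b where b: "b \<in> Basis" "second_deriv h x0 b b > 0"
    by (rule hessian_diagonal_pos[OF open_ball x0 C nonneg h0 ne]) auto
  have sdS: "second_deriv h x0 c v = 0" if "c \<in> S" for c v
  proof -
    have "((\<lambda>y. frechet_derivative h (at y) c) has_derivative (\<lambda>v. 0)) (at x0)"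
      by (rule has_derivative_transform_within_open[OF has_derivative_const[of 0] open_ball x0])
        (simp add: hS that)
    from frechet_derivative_at[OF this, symmetric] show ?thesis
      by (simp add: second_deriv_def)
  qed
  have bS: "b \<notin> S" using sdS b by force
  obtain r' h' G where r': "r' > 0" "ball x0 r' \<subseteq> ?W"
    and Ch': "Ck_on (Suc (Suc m)) (ball x0 r') h'" and CG: "Ck_on m (ball x0 r') G"
    and hG: "\<And>x. x \<in> ball x0 r' \<Longrightarrow> h x = h' x + (G x)\<^sup>2"
    and nonneg': "\<And>x. x \<in> ball x0 r' \<Longrightarrow> h' x \<ge> 0" and h'0: "h' x0 = 0"
    and h'b: "\<And>x. x \<in> ball x0 r' \<Longrightarrow> frechet_derivative h' (at x) b = 0"
    and h'S: "\<And>c x. \<forall>y\<in>?W. frechet_derivative h (at y) c = 0 \<Longrightarrow> x \<in> ball x0 r' \<Longrightarrow>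
        frechet_derivative h' (at x) c = 0"
    and sd: "\<And>c v. c \<in> Basis \<Longrightarrow> second_deriv h' x0 c v = second_deriv h x0 c v -
        second_deriv h x0 b v / second_deriv h x0 b b * second_deriv h x0 c b"
    by (rule eliminate_coordinate[OF open_ball x0 C nonneg h0 b]) (assumption, rule that)
  have r'r: "r' \<le> r"
    using r' by (simp add: ball_subset_ball_iff)
  have fin: "finite S" using S finite_Basis finite_subset by blast
  define F' where "F' c = (if c = b then G else F c)" for c
  have "f x = h' x + (\<Sum>c\<in>insert b S. (F' c x)\<^sup>2)" if "x \<in> ball x0 r'" for x
  proof -
    have "(\<Sum>c\<in>S. (F' c x)\<^sup>2) = (\<Sum>c\<in>S. (F c x)\<^sup>2)"
      using bS by (intro sum.cong) (auto simp: F'_def)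
    then show ?thesis
      using f[of x] hG[OF that] that r'(2) fin bS by (auto simp: F'_def)
  qed
  moreover have "Ck_on m (ball x0 r') (F' c)" if "c \<in> insert b S" for c
    using that CG Ck_on_subset[OF CF r'(2)] by (auto simp: F'_def)
  moreover have "frechet_derivative h' (at x) c = 0" if "c \<in> insert b S" "x \<in> ball x0 r'" for c x
    using that h'b h'S hS by blast
  moreover have "hessian h' x0 v = 0" if "hessian f x0 v = 0" for v
    using ker[OF that] b by (simp add: hessian_eq_0_iff sd)
  \<comment> \<open>The functional \<open>second_deriv h x0 b\<close> vanishes on \<open>S\<close>
    by symmetry and at \<open>v\<close> by \<open>ker\<close>, but is positive at \<open>b\<close>.
    So \<open>v\<close> has no \<open>b\<close>-component and the previous transversality
    applies.\<close>
  moreover have "v = 0" if v: "v \<in> span (insert b S)" "hessian f x0 v = 0" for v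
  proof -
    obtain k where k: "v - k *\<^sub>R b \<in> span S"
      using v(1) span_breakdown_eq by blast
    have lin: "linear (second_deriv h x0 b)"
      using linear_second_deriv[OF C x0 b(1)] .
    have "second_deriv h x0 b c = 0" if "c \<in> S" for c
      using second_deriv_commute[of ?W h x0 b c] Ck_on_le[OF C, of 2] sdS[OF that] b S that x0 by auto
    then have "second_deriv h x0 b (v - k *\<^sub>R b) = 0"
      using linear_eq_0_on_span[OF lin _ k] by blast
    moreover have "second_deriv h x0 b v = 0"
      using ker[OF v(2)] b(1) by (simp add: hessian_eq_0_iff)
    ultimately have "k = 0"
      using b(2) by (simp add: linear_diff[OF lin] linear_scale[OF lin])
    then show ?thesis
      using k trans v(2) by simp
  qed
  moreover have "hessian_rank f x0 \<le> hessian_rank h' x0 + card (insert b S)"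
  proof -
    \<comment> \<open>Old Hessian and Schur complement differ by a rank-one term along column
      \<open>b\<close>, so the rank drops by at most one.\<close>
    have "hessian h x0 v = hessian h' x0 v + (second_deriv h x0 b v / second_deriv h x0 b b) *\<^sub>R hessian h x0 b" for v
      by (subst euclidean_eq_iff) (auto simp: inner_add_left hessian_inner_Basis sd)
    moreover have "hessian h' x0 v + k *\<^sub>R hessian h x0 b
        \<in> span (insert (hessian h x0 b) (range (hessian h' x0)))" for v k
      by (intro span_add span_scale span_base) auto
    ultimately have "range (hessian h x0) \<subseteq> span (insert (hessian h x0 b) (range (hessian h' x0)))"
      by (metis (no_types, lifting) image_subsetI)
    then have "hessian_rank h x0 \<le> dim (insert (hessian h x0 b) (range (hessian h' x0)))"
      unfolding hessian_rank_def by (metis dim_span dim_subset)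
    also have "\<dots> \<le> hessian_rank h' x0 + 1"
      by (simp add: dim_insert hessian_rank_def)
    finally show ?thesis
      using rank fin bS by simp
  qed
  ultimately have "square_reduction m f x0 (insert b S) r' h' F'"
    using S b(1) r'(1) Ch' nonneg' h'0 unfolding square_reduction_def by blast
  then show ?thesis
    using that bS b(1) r'r by blast
qed

lemma square_reduction_complete:
  fixes f :: "'a::euclidean_space \<Rightarrow> real"
  assumes "square_reduction m f x0 S r h F"
  shows "\<exists>S' r' h' F'. r' \<le> r \<and> square_reduction m f x0 S' r' h' F' \<and> (\<forall>v. hessian h' x0 v = 0)"
proof -
  \<comment> \<open>\<open>n\<close> bounds the number of remaining steps; at \<open>n = 0\<close>
    the set \<open>S\<close> would be larger than \<open>Basis\<close>.\<close>
  have "\<exists>S' r' h' F'. r' \<le> r \<and> square_reduction m f x0 S' r' h' F' \<and> (\<forall>v. hessian h' x0 v = 0)"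
    if "square_reduction m f x0 S r h F" "DIM('a) < n + card S" for n S r h F
    using that
  proof (induction n arbitrary: S r h F)
    case 0
    have "S \<subseteq> Basis"
      using 0(1) by (simp add: square_reduction_def)
    then have "card S \<le> DIM('a)"
      by (intro card_mono) auto
    then show ?case using 0(2) by simp
  next
    case (Suc n)
    show ?case
    proof (cases "\<forall>v. hessian h x0 v = 0")
      case True
      then show ?thesis using Suc.prems(1) order_refl[of r] by blast
    next
      case False
      then obtain w where w: "hessian h x0 w \<noteq> 0" by blast
      obtain b r' h' F' where b: "b \<in> Basis - S" "r' \<le> r"
        and red: "square_reduction m f x0 (insert b S) r' h' F'"
        by (rule square_reduction_step[OF Suc.prems(1) w])
      have "S \<subseteq> Basis"
        using Suc.prems(1) by (simp add: square_reduction_def)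
      then have "finite S"
        using finite_Basis finite_subset by blast
      then have "DIM('a) < n + card (insert b S)"
        using b(1) Suc.prems(2) by simp
      from Suc.IH[OF red this] obtain S'' r'' h'' F'' where *: "r'' \<le> r'"
        "square_reduction m f x0 S'' r'' h'' F''" "\<forall>v. hessian h'' x0 v = 0"
        by blast
      from *(1) b(2) have "r'' \<le> r" by (rule order_trans)
      then show ?thesis using * by blast
    qed
  qed
  from this[OF assms, of "Suc DIM('a)"] show ?thesis by simp
qed

section \<open>Projecting the zero manifold onto the remaining coordinates\<close>

lemma proj_on_inner:
  assumes "B \<subseteq> Basis" "b \<in> Basis"
  shows "proj_on B y \<bullet> b = (if b \<in> B then y \<bullet> b else 0)"
proof -
  have fin: "finite B" using assms finite_Basis finite_subset by blast
  have "proj_on B y \<bullet> b = (\<Sum>c\<in>B. if c = b then y \<bullet> c else 0)"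
    unfolding proj_on_def inner_sum_left
    using assms by (intro sum.cong) (auto simp: inner_Basis)
  then show ?thesis
    using fin by simp
qed

lemma bounded_linear_proj_on: "bounded_linear (proj_on B)"
  unfolding proj_on_def
  by (intro bounded_linear_sum bounded_linear_compose[OF bounded_linear_scaleR_left bounded_linear_inner_left])

lemma proj_on_mem_span: "proj_on B y \<in> span B"
  unfolding proj_on_def by (intro span_sum span_scale span_base)

lemma Ck_vec_on_imp_continuous_on:
  assumes "Ck_vec_on k S g"
  shows "continuous_on S g"
  using assms Ck_on_imp_continuous_on unfolding Ck_vec_on_def
  by (subst continuous_on_componentwise) blast

lemma Ck_vec_on_imp_differentiable:
  assumes "Ck_vec_on k S g" "k \<ge> 1" "x \<in> S"
  shows "g differentiable (at x)"
proof -
  have "(\<lambda>x. g x \<bullet> c) differentiable (at x)" if "c \<in> Basis" for c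
    using assms that Ck_on_le[of k S "\<lambda>x. g x \<bullet> c" 1] by (auto simp: Ck_vec_on_def)
  then show ?thesis
    by (subst differentiable_componentwise_within) blast
qed

text \<open>The projection of \<open>N\<close> along \<open>span S\<close> covers a neighbourhood: its differential is injective
  because tangent vectors lie in the kernel of the Hessian, which meets \<open>span S\<close> trivially.\<close>

lemma submanifold_projection_covers:
  fixes f :: "'a::euclidean_space \<Rightarrow> real"
  assumes \<Omega>: "open \<Omega>" and C: "Ck_on (Suc (Suc m)) \<Omega> f" and nonneg: "\<And>x. x \<in> \<Omega> \<Longrightarrow> f x \<ge> 0"
    and N: "submanifold k d0 N" "k \<ge> 1" "x0 \<in> N" "N \<subseteq> {x \<in> \<Omega>. f x = 0}"
    and S: "S \<subseteq> Basis" "DIM('a) - d0 \<le> card S"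
    and trans: "\<And>v. v \<in> span S \<Longrightarrow> hessian f x0 v = 0 \<Longrightarrow> v = 0"
    and r: "r > 0"
  obtains r' where "r' > 0" "r' \<le> r"
    "\<And>x. x \<in> ball x0 r' \<Longrightarrow> \<exists>z\<in>N \<inter> ball x0 r. x - z \<in> span S"
proof -
  obtain B U V and \<phi> :: "'a \<Rightarrow> 'a" where chart: "B \<subseteq> Basis \<and> card B = d0 \<and>
        U \<subseteq> span B \<and> openin (top_of_set (span B)) U \<and> 0 \<in> U \<and> open V \<and>
        Ck_vec_on k {y. proj_on B y \<in> U} (\<phi> \<circ> proj_on B) \<and>
        \<phi> 0 = x0 \<and> \<phi> ` U = N \<inter> V \<and>
        (\<exists>\<psi>::'a \<Rightarrow> 'a. homeomorphism U (\<phi> ` U) \<phi> \<psi>) \<and>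
        inj_on (frechet_derivative (\<phi> \<circ> proj_on B) (at 0)) (span B)"
    using N(1)[unfolded submanifold_def, rule_format, OF N(3)] by (elim exE)
  then have B: "B \<subseteq> Basis" "card B = d0"
    and U: "openin (top_of_set (span B)) U" "0 \<in> U"
    and C\<phi>: "Ck_vec_on k {y. proj_on B y \<in> U} (\<phi> \<circ> proj_on B)"
    and \<phi>0: "\<phi> 0 = x0" and \<phi>U: "\<phi> ` U = N \<inter> V"
    and inj: "inj_on (frechet_derivative (\<phi> \<circ> proj_on B) (at 0)) (span B)"
    by simp_all
  define \<Phi> where "\<Phi> = \<phi> \<circ> proj_on B"
  define Y where "Y = {y. proj_on B y \<in> U}"
  define D where "D = frechet_derivative \<Phi> (at 0)"
  define P where "P = proj_on (Basis - S)"
  obtain O' where O': "open O'" "U = span B \<inter> O'"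
    using U(1) openin_open by blast
  have "Y = proj_on B -` O'"
    using proj_on_mem_span[of B] by (auto simp: Y_def O')
  then have "open Y"
    using open_vimage[OF O'(1) bounded_linear.continuous_on[OF bounded_linear_proj_on continuous_on_id]]
    by simp
  have proj0: "proj_on B 0 = 0"
    by (simp add: proj_on_def)
  then have "0 \<in> Y" using U by (simp add: Y_def)
  have contP: "continuous_on X P" for X
    unfolding P_def by (intro bounded_linear.continuous_on[OF bounded_linear_proj_on] continuous_on_id)
  have cont: "continuous_on Y \<Phi>"
    using Ck_vec_on_imp_continuous_on[OF C\<phi>] by (simp add: \<Phi>_def Y_def)
  have D: "(\<Phi> has_derivative D) (at 0)"
    using Ck_vec_on_imp_differentiable[OF C\<phi> N(2)] \<open>0 \<in> Y\<close>
    by (simp add: \<Phi>_def Y_def D_def frechet_derivative_works)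
  have \<Phi>0: "\<Phi> 0 = x0" by (simp add: \<Phi>_def proj0 \<phi>0)
  have \<Phi>N: "\<Phi> y \<in> N" if "y \<in> Y" for y
    using \<phi>U that by (auto simp: \<Phi>_def Y_def)
  have x0: "x0 \<in> \<Omega>" using N by blast
  \<comment> \<open>All zeros of \<open>f\<close> are critical, so the gradient of \<open>f\<close>
    is constantly zero along the chart; the chain rule then places tangent vectors in the
    kernel.\<close>
  have tangent: "hessian f x0 (D v) = 0" for v
    unfolding hessian_eq_0_iff
  proof
    fix b :: 'a assume b: "b \<in> Basis"
    have "((\<lambda>y. frechet_derivative f (at y) b) has_derivative second_deriv f x0 b) (at (\<Phi> 0))"
      using second_deriv_has_derivative[OF C b x0] by (simp add: \<Phi>0)
    from has_derivative_compose[OF D this]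
    have "((\<lambda>y. frechet_derivative f (at (\<Phi> y)) b) has_derivative (\<lambda>v. second_deriv f x0 b (D v))) (at 0)" .
    moreover have "((\<lambda>y. frechet_derivative f (at (\<Phi> y)) b) has_derivative (\<lambda>v. 0)) (at 0)"
    proof (rule has_derivative_transform_within_open[OF has_derivative_const[of 0] \<open>open Y\<close> \<open>0 \<in> Y\<close>])
      fix y assume "y \<in> Y"
      then have "\<Phi> y \<in> \<Omega>" "f (\<Phi> y) = 0"
        using \<Phi>N N(4) by blast+
      then show "0 = frechet_derivative f (at (\<Phi> y)) b"
        using nonneg_zero_imp_critical[OF \<Omega> C nonneg] by simp
    qed
    ultimately have "(\<lambda>v. second_deriv f x0 b (D v)) = (\<lambda>v. 0)"
      by (rule has_derivative_unique)
    then show "second_deriv f x0 b (D v) = 0" by (rule fun_cong)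
  qed
  have fin: "finite S" "finite B"
    using S B finite_Basis finite_subset by blast+
  have "card (Basis - B) \<le> card S"
    using S(2) B fin by (simp add: card_Diff_subset)
  \<comment> \<open>The coordinates outside \<open>B\<close>, on which the chart does not depend,
    are matched injectively with directions in \<open>S\<close>; \<open>S\<close> is large enough by
    the bound on \<open>DIM('a) - d0\<close>.\<close>
  then obtain \<sigma> where \<sigma>: "\<sigma> ` (Basis - B) \<subseteq> S" "inj_on \<sigma> (Basis - B)"
    using card_le_inj[of "Basis - B" S] fin by auto
  define M where "M y = (\<Sum>b\<in>Basis - B. (y \<bullet> b) *\<^sub>R \<sigma> b)" for y
  have M: "bounded_linear M"
    unfolding M_def
    by (intro bounded_linear_sum bounded_linear_compose[OF bounded_linear_scaleR_left bounded_linear_inner_left])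
  have M_out: "M y \<bullet> c = 0" if c: "c \<in> Basis - S" for y c
  proof -
    have "\<sigma> b \<bullet> c = 0" if "b \<in> Basis - B" for b
      using \<sigma>(1) S(1) c that by (subst inner_Basis) auto
    then show ?thesis by (simp add: M_def inner_sum_left)
  qed
  have M_in: "M y \<bullet> \<sigma> b = y \<bullet> b" if b: "b \<in> Basis - B" for y b
  proof -
    have "M y \<bullet> \<sigma> b = (\<Sum>c\<in>Basis - B. if c = b then y \<bullet> c else 0)"
      unfolding M_def inner_sum_left
    proof (intro sum.cong refl)
      fix c assume c: "c \<in> Basis - B"
      have "\<sigma> c \<bullet> \<sigma> b = (if c = b then 1 else 0)"
        using \<sigma> S(1) b c by (subst inner_Basis) (auto dest: inj_onD)
      then show "(y \<bullet> c) *\<^sub>R \<sigma> c \<bullet> \<sigma> b = (if c = b then y \<bullet> c else 0)" by simp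
    qed
    then show ?thesis using b by simp
  qed
  have P_in: "P y \<bullet> c = (if c \<in> S then 0 else y \<bullet> c)" if "c \<in> Basis" for y c
    using that by (simp add: P_def proj_on_inner)
  \<comment> \<open>Adding \<open>M\<close> turns the projected chart into a map of the whole space
    to itself, so that injectivity of its derivative gives surjectivity. \<open>P\<close> has no
    components in \<open>S\<close> and \<open>M\<close> no others, so the two do not
    interfere.\<close>
  define G where "G y = P (\<Phi> y) + M y" for y
  define G' where "G' v = P (D v) + M v" for v
  have G: "(G has_derivative G') (at 0)"
    unfolding G_def G'_def P_def
    by (intro has_derivative_add bounded_linear.has_derivative[OF bounded_linear_proj_on] D
        bounded_linear_imp_has_derivative M)
  have linG: "linear G'" using has_derivative_linear[OF G] .
  have "v = 0" if G0: "G' v = 0" for v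
  proof -
    have "v \<bullet> b = 0" if b: "b \<in> Basis - B" for b
    proof -
      have "\<sigma> b \<in> S" "\<sigma> b \<in> Basis" using \<sigma>(1) S(1) b by auto
      then have "G' v \<bullet> \<sigma> b = v \<bullet> b"
        using M_in[OF b] P_in by (simp add: G'_def inner_add_left)
      then show ?thesis using G0 by simp
    qed
    then have "v \<in> span B"
      by (rule mem_span_Basis_subset[OF B(1)])
    \<comment> \<open>Since \<open>G' v = 0\<close>, the components of \<open>D v\<close> outside
      \<open>S\<close> vanish; a tangent vector in \<open>span S\<close> is zero by
      transversality.\<close>
    moreover have "D v = 0"
    proof (rule trans[OF mem_span_Basis_subset[OF S(1)] tangent])
      fix c assume c: "c \<in> Basis - S"
      have "G' v \<bullet> c = D v \<bullet> c"
        using M_out[OF c] P_in c by (simp add: G'_def inner_add_left)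
      then show "D v \<bullet> c = 0" using G0 by simp
    qed
    moreover have "D 0 = 0"
      using linear_0[OF has_derivative_linear[OF D]] .
    ultimately show ?thesis
      using inj span_zero[of B] unfolding D_def \<Phi>_def inj_on_def by metis
  qed
  then have "inj G'"
    using linG linear_injective_0 by blast
  then obtain R where R: "linear R" "G' \<circ> R = id"
    using linG linear_injective_imp_surjective linear_surjective_right_inverse by metis
  define Y' where "Y' = Y \<inter> \<Phi> -` ball x0 r"
  have Y': "open Y'" "0 \<in> Y'" "Y' \<subseteq> Y"
    using continuous_open_preimage[OF cont \<open>open Y\<close> open_ball] \<open>0 \<in> Y\<close> \<Phi>0 r by (auto simp: Y'_def)
  have contG: "continuous_on Y' G"
    unfolding G_def
    by (intro continuous_on_add continuous_on_compose2[OF contP[of UNIV] continuous_on_subset[OF cont Y'(3)]]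
        bounded_linear.continuous_on[OF M] continuous_on_id) simp
  \<comment> \<open>This open mapping theorem needs continuity and the derivative at a single point,
    so charts of class C^1 suffice.\<close>
  have "G 0 \<in> interior (G ` Y')"
    using sussmann_open_mapping[OF Y'(1) contG Y'(2) G _ R(2) order_refl] R(1) Y'
    by (simp add: linear_conv_bounded_linear interior_open)
  moreover have "G 0 = P x0"
    using linear_0[OF bounded_linear.linear[OF M]] by (simp add: G_def \<Phi>0)
  ultimately have "x0 \<in> P -` interior (G ` Y')" by simp
  moreover have "open (P -` interior (G ` Y'))"
    using contP[of UNIV] by (intro open_vimage open_interior)
  ultimately obtain e where e: "e > 0" "ball x0 e \<subseteq> P -` interior (G ` Y')"
    using openE by blast
  show ?thesis
  proof (rule that[of "min e r"])
    fix x assume "x \<in> ball x0 (min e r)"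
    then have "P x \<in> G ` Y'"
      using e(2) interior_subset[of "G ` Y'"] by auto
    then obtain y where y: "y \<in> Y'" "P x = G y" by blast
    have "(x - \<Phi> y) \<bullet> c = 0" if c: "c \<in> Basis - S" for c
    proof -
      have "P x \<bullet> c = x \<bullet> c" "G y \<bullet> c = \<Phi> y \<bullet> c"
        using c P_in M_out[OF c] by (simp_all add: G_def inner_add_left)
      then show ?thesis using y(2) by (simp add: inner_diff_left)
    qed
    then have "x - \<Phi> y \<in> span S"
      by (rule mem_span_Basis_subset[OF S(1)])
    moreover have "\<Phi> y \<in> N \<inter> ball x0 r"
      using y(1) \<Phi>N by (simp add: Y'_def)
    ultimately show "\<exists>z\<in>N \<inter> ball x0 r. x - z \<in> span S" by blast
  qed (use e r in auto)
qed

text \<open>\<open>Basis\<close> acts as an index set with \<open>DIM('a)\<close> elements; shorter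
  sums are padded with zero functions so that all charts look alike.\<close>

definition local_sos :: "nat \<Rightarrow> 'a::euclidean_space set \<Rightarrow> ('a \<Rightarrow> real) \<Rightarrow> ('a \<Rightarrow> 'a \<Rightarrow> real) \<Rightarrow> bool" where
  "local_sos q V f F \<longleftrightarrow>
    (\<forall>b\<in>Basis. Ck_on q V (F b)) \<and> (\<forall>x\<in>V. f x = (\<Sum>b\<in>Basis. (F b x)\<^sup>2))"

text \<open>On the manifold \<open>f\<close> is zero, hence so is the non-negative remainder
  \<open>h\<close>. As \<open>h\<close> is constant along the eliminated directions, and the
  manifold covers a neighbourhood along them, \<open>h\<close> vanishes near
  \<open>x0\<close>.\<close>

lemma local_sos_at_zero:
  fixes f :: "'a::euclidean_space \<Rightarrow> real"
  assumes \<Omega>: "open \<Omega>" and C: "Ck_on (Suc (Suc m)) \<Omega> f" and nonneg: "\<And>x. x \<in> \<Omega> \<Longrightarrow> f x \<ge> 0"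
    and x0: "x0 \<in> \<Omega>" "f x0 = 0" and nhc: "NHC f {x \<in> \<Omega>. f x = 0} x0"
  shows "\<exists>r>0. ball x0 r \<subseteq> \<Omega> \<and> (\<exists>F. local_sos m (ball x0 r) f F)"
proof -
  obtain e where e: "e > 0" "ball x0 e \<subseteq> \<Omega>"
    using \<Omega> x0 openE by blast
  have "square_reduction m f x0 {} e f (\<lambda>_ _. 0)"
    using e nonneg x0 Ck_on_subset[OF C e(2)] by (auto simp: square_reduction_def)
  from square_reduction_complete[OF this]
  obtain S r h F where re: "r \<le> e" and red: "square_reduction m f x0 S r h F"
    and H0: "\<And>v. hessian h x0 v = 0" by blast
  have S: "S \<subseteq> Basis" and r: "r > 0" and Ch: "Ck_on (Suc (Suc m)) (ball x0 r) h"
    and hnonneg: "\<And>x. x \<in> ball x0 r \<Longrightarrow> h x \<ge> 0"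
    and hS: "\<And>b x. b \<in> S \<Longrightarrow> x \<in> ball x0 r \<Longrightarrow> frechet_derivative h (at x) b = 0"
    and CF: "\<And>b. b \<in> S \<Longrightarrow> Ck_on m (ball x0 r) (F b)"
    and f: "\<And>x. x \<in> ball x0 r \<Longrightarrow> f x = h x + (\<Sum>b\<in>S. (F b x)\<^sup>2)"
    and trans: "\<And>v. v \<in> span S \<Longrightarrow> hessian f x0 v = 0 \<Longrightarrow> v = 0"
    and rank: "hessian_rank f x0 \<le> hessian_rank h x0 + card S"
    using red unfolding square_reduction_def by blast+
  have "hessian_rank h x0 = 0"
    using H0 by (auto simp: hessian_rank_def dim_eq_0)
  \<comment> \<open>The elimination has used up the full rank, which by the normal Hessian condition
    is the codimension of the manifold.\<close>
  then have rank_S: "hessian_rank f x0 \<le> card S" using rank by simp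
  obtain d0 N k where N: "submanifold k d0 N" "k \<ge> 1" "x0 \<in> N" "N \<subseteq> {x \<in> \<Omega>. f x = 0}"
    and d0: "hessian_rank f x0 = DIM('a) - d0"
    using nhc unfolding NHC_def by blast
  obtain r' where r': "r' > 0" "r' \<le> r"
    and cover: "\<And>x. x \<in> ball x0 r' \<Longrightarrow> \<exists>z\<in>N \<inter> ball x0 r. x - z \<in> span S"
    by (rule submanifold_projection_covers[OF \<Omega> C nonneg N S rank_S[unfolded d0] trans r])
      (assumption, assumption, assumption, rule that)
  have sub: "ball x0 r' \<subseteq> ball x0 r" using r' by (simp add: subset_ball)
  have "h x = 0" if x: "x \<in> ball x0 r'" for x
  proof -
    obtain z where z: "z \<in> N" "z \<in> ball x0 r" "x - z \<in> span S"
      using cover[OF x] by blast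
    have "f z = 0" using z(1) N(4) by blast
    moreover have "(\<Sum>b\<in>S. (F b z)\<^sup>2) \<ge> 0" by (simp add: sum_nonneg)
    ultimately have "h z = 0"
      using f[OF z(2)] hnonneg[OF z(2)] by linarith
    moreover have "h x = h z"
      using x sub z hS by (intro constant_along_span[OF Ch convex_ball]) auto
    ultimately show ?thesis by simp
  qed
  then have fS: "f x = (\<Sum>b\<in>S. (F b x)\<^sup>2)" if "x \<in> ball x0 r'" for x
    using f[of x] sub that by auto
  define F' where "F' b = (if b \<in> S then F b else (\<lambda>_. 0))" for b
  have "f x = (\<Sum>b\<in>Basis. (F' b x)\<^sup>2)" if "x \<in> ball x0 r'" for x
    unfolding fS[OF that] using S by (intro sum.mono_neutral_cong_left) (auto simp: F'_def)
  moreover have "Ck_on m (ball x0 r') (F' b)" for b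
    using Ck_on_subset[OF CF sub] by (auto simp: F'_def Ck_on_const)
  ultimately have "local_sos m (ball x0 r') f F'"
    by (simp add: local_sos_def)
  moreover have "ball x0 r' \<subseteq> \<Omega>"
    using sub re e(2) subset_ball[of r e x0] by blast
  ultimately show ?thesis
    using r'(1) by blast
qed

lemma local_sos_sqrt:
  fixes f :: "'a::euclidean_space \<Rightarrow> real"
  assumes "open V" "Ck_on q V f" "\<And>x. x \<in> V \<Longrightarrow> f x > 0" "b0 \<in> Basis"
  shows "local_sos q V f (\<lambda>b x. if b = b0 then sqrt (f x) else 0)"
proof -
  have "f x = (\<Sum>b\<in>Basis. (if b = b0 then sqrt (f x) else 0)\<^sup>2)" if "x \<in> V" for x
  proof -
    have "(\<Sum>b\<in>Basis. (if b = b0 then sqrt (f x) else 0)\<^sup>2) = (\<Sum>b\<in>Basis. if b = b0 then f x else 0)"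
      using assms(3)[OF that] by (intro sum.cong) auto
    then show ?thesis using assms(4) by simp
  qed
  moreover have "Ck_on q V (\<lambda>x. if b = b0 then sqrt (f x) else 0)" for b
    using Ck_on_sqrt[OF assms(1-3)] by (cases "b = b0") (simp_all add: Ck_on_const)
  ultimately show ?thesis
    by (simp add: local_sos_def)
qed

section \<open>Partitions of unity by squares\<close>

lemma Ck_on_dist_power2:
  fixes c :: "'a::euclidean_space"
  assumes "open S"
  shows "Ck_on q S (\<lambda>x. (dist c x)\<^sup>2)"
proof -
  have "Ck_on q S (\<lambda>x. \<Sum>b\<in>Basis. (c \<bullet> b - x \<bullet> b)\<^sup>2)"
    using assms by (intro Ck_on_sum Ck_on_power2 Ck_on_diff Ck_on_const Ck_on_inner_left)
  moreover have "(\<Sum>b\<in>Basis. (c \<bullet> b - x \<bullet> b)\<^sup>2) = (dist c x)\<^sup>2" for x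
    unfolding dist_norm power2_norm_eq_inner euclidean_inner[of "c - x" "c - x"]
    by (simp add: inner_diff_left power2_eq_square)
  ultimately show ?thesis by simp
qed

text \<open>\<open>A\<close> is positive at distance below \<open>r / 2\<close> and \<open>B\<close>
  beyond \<open>r / 3\<close>. These regions overlap, so \<open>A\<close> and \<open>B\<close> have
  no common zero and can be divided by the root of the sum of their squares.\<close>

lemma cutoff_pair:
  fixes c :: "'a::euclidean_space"
  assumes "r > 0"
  obtains \<eta> \<theta> :: "'a \<Rightarrow> real" where "Ck_on q UNIV \<eta>" "Ck_on q UNIV \<theta>"
    "\<And>x. (\<eta> x)\<^sup>2 + (\<theta> x)\<^sup>2 = 1"
    "\<And>x. dist c x > r / 2 \<Longrightarrow> \<eta> x = 0" "\<And>x. dist c x < r / 3 \<Longrightarrow> \<theta> x = 0"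
proof -
  define A where "A x = max 0 ((r / 2)\<^sup>2 - (dist c x)\<^sup>2) ^ Suc q" for x
  define B where "B x = max 0 ((dist c x)\<^sup>2 - (r / 3)\<^sup>2) ^ Suc q" for x
  have C: "Ck_on q UNIV A" "Ck_on q UNIV B"
    unfolding A_def B_def
    by (intro Ck_on_max_0_power Ck_on_diff Ck_on_const Ck_on_dist_power2 open_UNIV lessI)+
  have "(r / 3)\<^sup>2 < (r / 2)\<^sup>2"
    using assms by (intro power_strict_mono) auto
  then have cases: "(dist c x)\<^sup>2 < (r / 2)\<^sup>2 \<or> (r / 3)\<^sup>2 < (dist c x)\<^sup>2" for x
    by linarith
  have Apos: "A x > 0" if "(dist c x)\<^sup>2 < (r / 2)\<^sup>2" for x
    unfolding A_def by (rule zero_less_power) (use that in linarith)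
  have Bpos: "B x > 0" if "(r / 3)\<^sup>2 < (dist c x)\<^sup>2" for x
    unfolding B_def by (rule zero_less_power) (use that in linarith)
  have "A x \<noteq> 0 \<or> B x \<noteq> 0" for x
    using cases[of x] Apos[of x] Bpos[of x] by linarith
  then have pos: "(A x)\<^sup>2 + (B x)\<^sup>2 > 0" for x
    by (simp only: sum_power2_gt_zero_iff)
  have sq: "Ck_on q UNIV (\<lambda>x. sqrt ((A x)\<^sup>2 + (B x)\<^sup>2))"
    using pos by (intro Ck_on_sqrt Ck_on_add Ck_on_power2 C open_UNIV)
  have ne: "sqrt ((A x)\<^sup>2 + (B x)\<^sup>2) \<noteq> 0" for x
    using real_sqrt_gt_zero[OF pos[of x]] by linarith
  show ?thesis
  proof (rule that)
    show "Ck_on q UNIV (\<lambda>x. A x / sqrt ((A x)\<^sup>2 + (B x)\<^sup>2))" "Ck_on q UNIV (\<lambda>x. B x / sqrt ((A x)\<^sup>2 + (B x)\<^sup>2))"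
      by (rule Ck_on_divide[OF open_UNIV C(1) sq ne] Ck_on_divide[OF open_UNIV C(2) sq ne])+
    show "(A x / sqrt ((A x)\<^sup>2 + (B x)\<^sup>2))\<^sup>2 + (B x / sqrt ((A x)\<^sup>2 + (B x)\<^sup>2))\<^sup>2 = 1" for x
    proof -
      have "(sqrt ((A x)\<^sup>2 + (B x)\<^sup>2))\<^sup>2 = (A x)\<^sup>2 + (B x)\<^sup>2"
        using pos[of x] by simp
      then show ?thesis
        by (simp only: power_divide add_divide_distrib[symmetric])
          (rule divide_self, use pos[of x] in linarith)
    qed
    show "A x / sqrt ((A x)\<^sup>2 + (B x)\<^sup>2) = 0" if "dist c x > r / 2" for x
    proof -
      have "(r / 2)\<^sup>2 \<le> (dist c x)\<^sup>2"
        using that assms by (intro power_mono) auto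
      then show ?thesis by (simp add: A_def max_def)
    qed
    show "B x / sqrt ((A x)\<^sup>2 + (B x)\<^sup>2) = 0" if "dist c x < r / 3" for x
    proof -
      have "(dist c x)\<^sup>2 \<le> (r / 3)\<^sup>2"
        using that by (intro power_mono) auto
      then show ?thesis by (simp add: B_def max_def)
    qed
  qed
qed

text \<open>Vanishing near each point of \<open>\<Omega>\<close> outside \<open>V j\<close> is the
  form of "support inside \<open>V j\<close>" that extension by zero requires.\<close>

definition subordinate_squares ::
  "nat \<Rightarrow> 'a::euclidean_space set \<Rightarrow> (nat \<Rightarrow> 'a set) \<Rightarrow> (nat \<Rightarrow> 'a \<Rightarrow> real) \<Rightarrow> bool" where
  "subordinate_squares q \<Omega> V e \<longleftrightarrow>
    (\<forall>j. Ck_on q \<Omega> (e j)) \<and>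
    (\<forall>j. \<forall>x\<in>\<Omega> - V j. \<exists>T. open T \<and> x \<in> T \<and> (\<forall>y\<in>T \<inter> \<Omega>. e j y = 0)) \<and>
    (\<forall>x\<in>\<Omega>. \<exists>T J. open T \<and> x \<in> T \<and> finite J \<and>
      (\<forall>y\<in>T \<inter> \<Omega>. (\<forall>j. j \<notin> J \<longrightarrow> e j y = 0) \<and> (\<Sum>j\<in>J. (e j y)\<^sup>2) = 1))"

text \<open>The telescoping functions \<open>\<eta>\<^sub>k \<cdot> \<theta>\<^sub>0 \<cdots> \<theta>\<^sub>k\<^sub>-\<^sub>1\<close> are locally finite for free: where \<open>\<theta>\<^sub>k\<close> vanishes, so
  do all those with larger index. Hence no locally finite refinement of the cover is needed.\<close>

lemma telescoping_squares:
  fixes \<eta> \<theta> :: "nat \<Rightarrow> real"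
  assumes "\<And>k. (\<eta> k)\<^sup>2 + (\<theta> k)\<^sup>2 = 1"
  shows "(\<Sum>k<n. (\<eta> k * (\<Prod>i<k. \<theta> i))\<^sup>2) + (\<Prod>i<n. \<theta> i)\<^sup>2 = 1"
proof (induction n)
  case (Suc n)
  have "(\<eta> n * (\<Prod>i<n. \<theta> i))\<^sup>2 + (\<Prod>i<Suc n. \<theta> i)\<^sup>2 = ((\<eta> n)\<^sup>2 + (\<theta> n)\<^sup>2) * (\<Prod>i<n. \<theta> i)\<^sup>2"
    by (simp add: power_mult_distrib algebra_simps)
  then show ?case
    using Suc assms[of n] by simp
qed simp

text \<open>Lindelof's theorem, with the countably many centres listed as a sequence, possibly with
  repetitions.\<close>

lemma countable_ball_cover:
  fixes \<Omega> :: "'a::euclidean_space set"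
  assumes "\<Omega> \<noteq> {}" "\<forall>x\<in>\<Omega>. R x > 0"
  shows "\<exists>c :: nat \<Rightarrow> 'a. (\<forall>k. c k \<in> \<Omega>) \<and> \<Omega> \<subseteq> (\<Union>k. ball (c k) (R (c k)))"
proof -
  obtain \<F> where \<F>: "\<F> \<subseteq> (\<lambda>x. ball x (R x)) ` \<Omega>" "countable \<F>"
    "\<Union>\<F> = (\<Union>x\<in>\<Omega>. ball x (R x))"
    using Lindelof[of "(\<lambda>x. ball x (R x)) ` \<Omega>"] by blast
  have "countable \<F> \<and> \<F> \<subseteq> (\<lambda>x. ball x (R x)) ` \<Omega>"
    using \<F> by blast
  then obtain C where C: "C \<subseteq> \<Omega>" "countable C" "\<F> = (\<lambda>x. ball x (R x)) ` C"
    unfolding countable_subset_image by (elim exE conjE) (rule that)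
  have cover: "\<exists>x\<in>C. y \<in> ball x (R x)" if "y \<in> \<Omega>" for y
  proof -
    have "y \<in> (\<Union>x\<in>\<Omega>. ball x (R x))"
      using that assms(2) by force
    then show ?thesis
      unfolding \<F>(3)[symmetric] C(3) by blast
  qed
  then have "C \<noteq> {}" using assms(1) by blast
  define c where "c = from_nat_into C"
  have rc: "range c = C"
    using C(2) \<open>C \<noteq> {}\<close> by (simp add: c_def range_from_nat_into)
  show ?thesis
  proof (intro exI[of _ c] conjI allI)
    show "c k \<in> \<Omega>" for k
      using rc C(1) by blast
    show "\<Omega> \<subseteq> (\<Union>k. ball (c k) (R (c k)))"
      using cover rc by blast
  qed
qed

text \<open>Small balls, each inside some \<open>V j\<close>, carry telescoping functions; these are
  then regrouped so that each \<open>V j\<close> receives exactly one function.\<close>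

lemma subordinate_squares_exists:
  fixes V :: "nat \<Rightarrow> 'a::euclidean_space set"
  assumes "open \<Omega>" "\<And>j. open (V j)" "\<Omega> \<subseteq> (\<Union>j. V j)"
  shows "\<exists>e. subordinate_squares q \<Omega> V e"
proof (cases "\<Omega> = {}")
  case True
  have "Ck_on q ({}::'a set) (\<lambda>_. 0)" by (rule Ck_on_const)
  then show ?thesis
    unfolding subordinate_squares_def True by (intro exI[of _ "\<lambda>_ _. 0"]) simp
next
  case False
  have "\<exists>j r. r > 0 \<and> ball x r \<subseteq> V j" if x: "x \<in> \<Omega>" for x
  proof -
    obtain j where "x \<in> V j" using x assms(3) by blast
    then show ?thesis using assms(2) openE by metis
  qed
  then obtain L R where LR: "\<And>x. x \<in> \<Omega> \<Longrightarrow> R x > 0" "\<And>x. x \<in> \<Omega> \<Longrightarrow> ball x (R x) \<subseteq> V (L x)"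
    by metis
  have R3: "\<forall>x\<in>\<Omega>. R x / 3 > 0"
    using LR(1) by simp
  obtain c :: "nat \<Rightarrow> 'a" where c: "(\<forall>k. c k \<in> \<Omega>) \<and> \<Omega> \<subseteq> (\<Union>k. ball (c k) (R (c k) / 3))"
    using countable_ball_cover[of \<Omega> "\<lambda>x. R x / 3", OF False R3] by blast
  then have c\<Omega>: "c k \<in> \<Omega>" for k by simp
  define \<rho> where "\<rho> k = R (c k)" for k
  define l where "l k = L (c k)" for k
  have \<rho>: "\<rho> k > 0" "ball (c k) (\<rho> k) \<subseteq> V (l k)" for k
    using LR c\<Omega> by (simp_all add: \<rho>_def l_def)
  define T where "T k = ball (c k) (\<rho> k / 3)" for k
  have T: "open (T k)" for k by (simp add: T_def)
  have ex_T: "\<exists>k. x \<in> T k" if "x \<in> \<Omega>" for x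
    using c that unfolding T_def \<rho>_def by blast
  have "\<forall>k. \<exists>\<eta> \<theta>. Ck_on q UNIV \<eta> \<and> Ck_on q UNIV \<theta> \<and> (\<forall>x. (\<eta> x)\<^sup>2 + (\<theta> x)\<^sup>2 = 1) \<and>
      (\<forall>x. dist (c k) x > \<rho> k / 2 \<longrightarrow> \<eta> x = 0) \<and> (\<forall>x. dist (c k) x < \<rho> k / 3 \<longrightarrow> \<theta> x = (0::real))"
    by (rule allI, rule cutoff_pair[OF \<rho>(1)]) blast
  then obtain \<eta> \<theta> where C\<eta>: "\<And>k. Ck_on q UNIV (\<eta> k)" and C\<theta>: "\<And>k. Ck_on q UNIV (\<theta> k)"
    and one: "\<And>k x. (\<eta> k x)\<^sup>2 + (\<theta> k x)\<^sup>2 = 1"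
    and \<eta>0: "\<And>k x. dist (c k) x > \<rho> k / 2 \<Longrightarrow> \<eta> k x = 0"
    and \<theta>0: "\<And>k x. dist (c k) x < \<rho> k / 3 \<Longrightarrow> \<theta> k x = 0"
    by metis
  define E where "E k x = \<eta> k x * (\<Prod>i<k. \<theta> i x)" for k x
  have CE: "Ck_on q UNIV (E k)" for k
    unfolding E_def by (intro Ck_on_mult Ck_on_prod open_UNIV C\<eta> C\<theta>)
  have E0: "E i x = 0" if "x \<in> T k" "k < i" for i k x
    using that \<theta>0[of k x] by (auto simp: E_def T_def)
  have sumE: "(\<Sum>i\<le>k. (E i x)\<^sup>2) = 1" if "x \<in> T k" for k x
  proof -
    have zero: "(\<Prod>i<Suc k. \<theta> i x) = 0"
      using that \<theta>0[of k x] by (simp add: T_def)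
    have "(\<Sum>i<Suc k. (\<eta> i x * (\<Prod>j<i. \<theta> j x))\<^sup>2) + (\<Prod>i<Suc k. \<theta> i x)\<^sup>2 = 1"
      by (rule telescoping_squares[OF one])
    then show ?thesis
      unfolding zero unfolding E_def lessThan_Suc_atMost by simp
  qed
  \<comment> \<open>The sums \<open>A k j\<close> over \<open>j\<close> add up to 1, but their roots
    may fail to be smooth at zeros. Hence \<open>A k j\<close> itself is used, divided by the root
    of the positive function \<open>D k\<close>.\<close>
  define A where "A k j x = (\<Sum>i\<in>{i\<in>{..k}. l i = j}. (E i x)\<^sup>2)" for k j x
  define D where "D k x = (\<Sum>j\<in>l ` {..k}. (A k j x)\<^sup>2)" for k x
  have CA: "Ck_on q UNIV (A k j)" for k j
    unfolding A_def by (intro Ck_on_sum Ck_on_power2 open_UNIV CE)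
  have CD: "Ck_on q UNIV (D k)" for k
    unfolding D_def by (intro Ck_on_sum Ck_on_power2 open_UNIV CA)
  have Dpos: "D k x > 0" if "x \<in> T k" for k x
  proof -
    have "(\<Sum>j\<in>l ` {..k}. A k j x) = 1"
      unfolding A_def using sumE[OF that] sum.image_gen[of "{..k}" "\<lambda>i. (E i x)\<^sup>2" l] by simp
    then obtain j where "j \<in> l ` {..k}" "A k j x \<noteq> 0"
      by (metis sum.neutral zero_neq_one)
    then show ?thesis
      unfolding D_def by (intro sum_pos2[of _ j]) auto
  qed
  have A_mono: "A k j x = A k' j x" if "x \<in> T k" "k \<le> k'" for k k' j x
    unfolding A_def using that(2) E0[OF that(1)]
    by (intro sum.mono_neutral_left) (auto simp: linorder_not_le[symmetric])
  have A_out: "A k j x = 0" if "j \<notin> l ` {..k}" for k j x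
    using that by (auto simp: A_def intro!: sum.neutral)
  have D_mono: "D k x = D k' x" if "x \<in> T k" "k \<le> k'" for k k' x
  proof -
    have "(\<Sum>j\<in>l ` {..k}. (A k' j x)\<^sup>2) = (\<Sum>j\<in>l ` {..k'}. (A k' j x)\<^sup>2)"
      using that A_out[of _ k x] A_mono[OF that] by (intro sum.mono_neutral_left) auto
    then show ?thesis
      using A_mono[OF that] by (simp add: D_def)
  qed
  \<comment> \<open>On \<open>T k\<close> the sums no longer change beyond \<open>k\<close>, so the
    choice of index does not affect the quotient \<open>e\<close>.\<close>
  define K where "K x = (LEAST k. x \<in> T k)" for x
  have K: "x \<in> T (K x)" "K x \<le> k" if "x \<in> T k" for k x
    using that by (auto simp: K_def intro: LeastI Least_le)
  define e where "e j x = A (K x) j x / sqrt (D (K x) x)" for j x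
  have e: "e j x = A k j x / sqrt (D k x)" if "x \<in> T k" for j k x
    using A_mono[OF K[OF that]] D_mono[OF K[OF that]] by (simp add: e_def)
  have Ce: "Ck_on q \<Omega> (e j)" for j
  proof (rule Ck_on_local[OF _ \<open>open \<Omega>\<close>])
    fix x assume "x \<in> \<Omega>"
    then obtain k where k: "x \<in> T k" using ex_T by blast
    have op: "open (T k \<inter> \<Omega>)" using T \<open>open \<Omega>\<close> by blast
    have "Ck_on q (T k \<inter> \<Omega>) (\<lambda>x. A k j x / sqrt (D k x))"
      using Dpos[of _ k] by (intro Ck_on_divide Ck_on_sqrt op Ck_on_subset[OF CA] Ck_on_subset[OF CD])
        (auto simp: order_less_imp_not_eq2)
    then have "Ck_on q (T k \<inter> \<Omega>) (e j)"
      by (rule Ck_on_cong[OF op, rotated]) (simp add: e[of _ k])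
    then show "\<exists>T. open T \<and> x \<in> T \<and> Ck_on q (T \<inter> \<Omega>) (e j)"
      using T k by blast
  qed
  have supp: "\<exists>T. open T \<and> x \<in> T \<and> (\<forall>y\<in>T \<inter> \<Omega>. e j y = 0)" if x: "x \<in> \<Omega> - V j" for j x
  proof -
    obtain k where k: "x \<in> T k" using ex_T x by blast
    \<comment> \<open>Only finitely many members of group \<open>j\<close> matter on
      \<open>T k\<close>. A point outside \<open>V j\<close> misses their full balls, so a
      neighbourhood of it misses the half-size closed balls carrying the
      \<open>\<eta> i\<close>.\<close>
    define X where "X = T k \<inter> (\<Inter>i\<in>{i\<in>{..k}. l i = j}. - cball (c i) (\<rho> i / 2))"
    have "open X"
      unfolding X_def by (intro open_Int T open_INT) auto
    moreover have "x \<in> X"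
    proof -
      have "x \<notin> cball (c i) (\<rho> i / 2)" if "l i = j" for i
      proof -
        have "x \<notin> ball (c i) (\<rho> i)"
          using \<rho>(2)[of i] x that by blast
        then show ?thesis using \<rho>(1)[of i] by auto
      qed
      then show ?thesis using k by (simp add: X_def)
    qed
    moreover have "e j y = 0" if "y \<in> X" for y
    proof -
      have "A k j y = 0"
        unfolding A_def using that \<eta>0 by (intro sum.neutral) (auto simp: X_def E_def)
      then show ?thesis using e[of y k j] that by (simp add: X_def)
    qed
    ultimately show ?thesis by blast
  qed
  have locfin: "\<exists>T J. open T \<and> x \<in> T \<and> finite J \<and>
      (\<forall>y\<in>T \<inter> \<Omega>. (\<forall>j. j \<notin> J \<longrightarrow> e j y = 0) \<and> (\<Sum>j\<in>J. (e j y)\<^sup>2) = 1)" if x: "x \<in> \<Omega>" for x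
  proof -
    obtain k where k: "x \<in> T k" using ex_T x by blast
    have out: "e j y = 0" if "y \<in> T k" "j \<notin> l ` {..k}" for j y
      using e[OF that(1), of j] A_out[OF that(2), of y] by simp
    have sum1: "(\<Sum>j\<in>l ` {..k}. (e j y)\<^sup>2) = 1" if "y \<in> T k" for y
    proof -
      have "(e j y)\<^sup>2 = (A k j y)\<^sup>2 / D k y" for j
        using e[OF that, of j] Dpos[OF that] by (simp add: power_divide)
      then have "(\<Sum>j\<in>l ` {..k}. (e j y)\<^sup>2) = (\<Sum>j\<in>l ` {..k}. (A k j y)\<^sup>2 / D k y)"
        by simp
      also have "\<dots> = (\<Sum>j\<in>l ` {..k}. (A k j y)\<^sup>2) / D k y"
        by (rule sum_divide_distrib[symmetric])
      also have "\<dots> = D k y / D k y"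
        by (simp only: D_def)
      finally show ?thesis
        using Dpos[OF that] by simp
    qed
    show ?thesis
      by (rule exI[of _ "T k"], rule exI[of _ "l ` {..k}"]) (use T k out sum1 in blast)
  qed
  show ?thesis
    unfolding subordinate_squares_def
    by (intro exI[of _ e] conjI allI ballI) (rule Ce, rule supp, assumption, rule locfin)
qed

section \<open>Gluing\<close>

lemma SOS_decomp_reindex:
  fixes G :: "'i \<Rightarrow> 'a::euclidean_space \<Rightarrow> real"
  assumes "countable K"
    and C: "\<And>i. i \<in> K \<Longrightarrow> Ck_on q \<Omega> (G i)"
    and locfin: "\<And>x. x \<in> \<Omega> \<Longrightarrow> \<exists>W. open W \<and> x \<in> W \<and>
        finite {i \<in> K. W \<inter> \<Omega> \<inter> closure {y \<in> \<Omega>. G i y \<noteq> 0} \<noteq> {}}"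
    and sum: "\<And>x. x \<in> \<Omega> \<Longrightarrow> ((\<lambda>i. (G i x)\<^sup>2) has_sum f x) K"
  shows "\<exists>I fs. SOS_decomp q \<Omega> f I fs \<and> (finite K \<longrightarrow> finite I) \<and> card I = card K"
proof -
  define \<iota> where "\<iota> = to_nat_on K"
  define fs where "fs n = G (inv_into K \<iota> n)" for n
  have inj: "inj_on \<iota> K"
    using \<open>countable K\<close> by (simp add: \<iota>_def inj_on_to_nat_on)
  have fs: "fs (\<iota> i) = G i" if "i \<in> K" for i
    using that inj by (simp add: fs_def)
  have "SOS_decomp q \<Omega> f (\<iota> ` K) fs"
    unfolding SOS_decomp_def
  proof (intro conjI ballI)
    show "Ck_on q \<Omega> (fs n)" if "n \<in> \<iota> ` K" for n
      using that C fs by auto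
  next
    fix x assume "x \<in> \<Omega>"
    from locfin[OF this] obtain W where W: "open W" "x \<in> W"
      "finite {i \<in> K. W \<inter> \<Omega> \<inter> closure {y \<in> \<Omega>. G i y \<noteq> 0} \<noteq> {}}" by blast
    have "{n \<in> \<iota> ` K. W \<inter> \<Omega> \<inter> closure {y \<in> \<Omega>. fs n y \<noteq> 0} \<noteq> {}}
        \<subseteq> \<iota> ` {i \<in> K. W \<inter> \<Omega> \<inter> closure {y \<in> \<Omega>. G i y \<noteq> 0} \<noteq> {}}"
    proof
      fix n assume n: "n \<in> {n \<in> \<iota> ` K. W \<inter> \<Omega> \<inter> closure {y \<in> \<Omega>. fs n y \<noteq> 0} \<noteq> {}}"
      then obtain i where i: "i \<in> K" "n = \<iota> i" by blast
      then have "W \<inter> \<Omega> \<inter> closure {y \<in> \<Omega>. G i y \<noteq> 0} \<noteq> {}"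
        using n fs[OF i(1)] by simp
      then show "n \<in> \<iota> ` {i \<in> K. W \<inter> \<Omega> \<inter> closure {y \<in> \<Omega>. G i y \<noteq> 0} \<noteq> {}}"
        using i by blast
    qed
    then have "finite {n \<in> \<iota> ` K. W \<inter> \<Omega> \<inter> closure {y \<in> \<Omega>. fs n y \<noteq> 0} \<noteq> {}}"
      using W(3) by (rule finite_subset[OF _ finite_imageI])
    then show "\<exists>W. open W \<and> x \<in> W \<and>
        finite {n \<in> \<iota> ` K. W \<inter> \<Omega> \<inter> closure {y \<in> \<Omega>. fs n y \<noteq> 0} \<noteq> {}}"
      using W(1,2) by (intro exI[of _ W]) simp
  next
    fix x assume x: "x \<in> \<Omega>"
    have "((\<lambda>n. (fs n x)\<^sup>2) \<circ> \<iota> has_sum f x) K"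
      using sum[OF x] by (rule has_sum_cong[THEN iffD1, rotated]) (simp add: fs)
    then show "((\<lambda>n. (fs n x)\<^sup>2) has_sum f x) (\<iota> ` K)"
      using has_sum_reindex[OF inj] by blast
  qed
  moreover have "card (\<iota> ` K) = card K"
    using inj by (rule card_image)
  ultimately show ?thesis by blast
qed

text \<open>The products of \<open>e j\<close> with the local functions have squares summing to
  \<open>f\<close> times the sum of the \<open>(e j x)\<^sup>2\<close>. The set \<open>K\<close>
  lists the pairs that may contribute, which makes the sharp count in the strict case
  possible.\<close>

lemma SOS_decomp_from_charts:
  fixes f :: "'a::euclidean_space \<Rightarrow> real" and V :: "nat \<Rightarrow> 'a set"
  assumes \<Omega>: "open \<Omega>" and V: "\<And>j. open (V j)" "\<And>j. V j \<subseteq> \<Omega>" "\<Omega> \<subseteq> (\<Union>j. V j)"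
    and sos: "\<And>j. local_sos q (V j) f (F j)"
    and K: "K \<subseteq> UNIV \<times> Basis"
    and outside: "\<And>j b x. b \<in> Basis \<Longrightarrow> x \<in> V j \<Longrightarrow> (j, b) \<notin> K \<Longrightarrow> F j b x = 0"
  shows "\<exists>I fs. SOS_decomp q \<Omega> f I fs \<and> (finite K \<longrightarrow> finite I) \<and> card I = card K"
proof -
  obtain e where "subordinate_squares q \<Omega> V e"
    using subordinate_squares_exists[OF \<Omega> V(1,3)] by blast
  then have Ce: "\<And>j. Ck_on q \<Omega> (e j)"
    and supp: "\<And>j x. x \<in> \<Omega> - V j \<Longrightarrow> \<exists>T. open T \<and> x \<in> T \<and> (\<forall>y\<in>T \<inter> \<Omega>. e j y = 0)"
    and unity: "\<And>x. x \<in> \<Omega> \<Longrightarrow> \<exists>T J. open T \<and> x \<in> T \<and> finite J \<and>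
      (\<forall>y\<in>T \<inter> \<Omega>. (\<forall>j. j \<notin> J \<longrightarrow> e j y = 0) \<and> (\<Sum>j\<in>J. (e j y)\<^sup>2) = 1)"
    unfolding subordinate_squares_def by simp_all
  define G where "G = (\<lambda>(j, b) x. if x \<in> V j then e j x * F j b x else 0)"
  have CF: "Ck_on q (V j) (F j b)" if "b \<in> Basis" for j b
    using sos that by (simp add: local_sos_def)
  show ?thesis
  proof (rule SOS_decomp_reindex)
    show "countable K"
      using K by (rule countable_subset) (simp add: countable_finite)
  next
    fix i assume "i \<in> K"
    then obtain j b where i: "i = (j, b)" "b \<in> Basis"
      using K by auto
    show "Ck_on q \<Omega> (G i)"
    proof (rule Ck_on_local[OF _ \<Omega>])
      fix x assume x: "x \<in> \<Omega>"
      show "\<exists>T. open T \<and> x \<in> T \<and> Ck_on q (T \<inter> \<Omega>) (G i)"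
      proof (cases "x \<in> V j")
        case True
        have "Ck_on q (V j) (\<lambda>x. e j x * F j b x)"
          by (rule Ck_on_mult[OF V(1) Ck_on_subset[OF Ce V(2)] CF[OF i(2)]])
        then have "Ck_on q (V j) (G i)"
          by (rule Ck_on_cong[OF V(1), rotated]) (simp add: G_def i)
        then have "Ck_on q (V j \<inter> \<Omega>) (G i)"
          by (rule Ck_on_subset) simp
        then show ?thesis using True V(1) by blast
      next
        case False
        then obtain T where T: "open T" "x \<in> T" "\<And>y. y \<in> T \<inter> \<Omega> \<Longrightarrow> e j y = 0"
          using supp[of x j] x by blast
        have "Ck_on q (T \<inter> \<Omega>) (G i)"
          by (rule Ck_on_cong[OF open_Int[OF T(1) \<Omega>] _ Ck_on_const[of _ _ 0]])
            (use T(3) in \<open>simp add: G_def i\<close>)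
        then show ?thesis using T(1,2) by blast
      qed
    qed
  next
    fix x assume x: "x \<in> \<Omega>"
    obtain T J where T: "open T" "x \<in> T" "finite J"
      and out: "\<And>y j. y \<in> T \<inter> \<Omega> \<Longrightarrow> j \<notin> J \<Longrightarrow> e j y = 0"
      and one: "\<And>y. y \<in> T \<inter> \<Omega> \<Longrightarrow> (\<Sum>j\<in>J. (e j y)\<^sup>2) = 1"
      using unity[OF x] by blast
    have G0: "G (j, b) y = 0" if "y \<in> T \<inter> \<Omega>" "j \<notin> J" for j b y
      using out[OF that] by (simp add: G_def)
    have "{i \<in> K. T \<inter> \<Omega> \<inter> closure {y \<in> \<Omega>. G i y \<noteq> 0} \<noteq> {}} \<subseteq> J \<times> Basis"
    proof
      fix i assume "i \<in> {i \<in> K. T \<inter> \<Omega> \<inter> closure {y \<in> \<Omega>. G i y \<noteq> 0} \<noteq> {}}"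
      \<comment> \<open>An open set meeting a closure meets the set itself, so vanishing on
        \<open>T\<close> also bounds the number of supports met.\<close>
      then have i: "i \<in> K" "T \<inter> \<Omega> \<inter> {y \<in> \<Omega>. G i y \<noteq> 0} \<noteq> {}"
        using open_Int_closure_eq_empty[OF open_Int[OF T(1) \<Omega>]] by auto
      obtain j b where jb: "i = (j, b)" "b \<in> Basis" using i(1) K by auto
      then have "j \<in> J" using i(2) G0 by blast
      then show "i \<in> J \<times> Basis" using jb by simp
    qed
    then have "finite {i \<in> K. T \<inter> \<Omega> \<inter> closure {y \<in> \<Omega>. G i y \<noteq> 0} \<noteq> {}}"
      using T(3) by (rule finite_subset[OF _ finite_cartesian_product]) simp
    then show "\<exists>W. open W \<and> x \<in> W \<and> finite {i \<in> K. W \<inter> \<Omega> \<inter> closure {y \<in> \<Omega>. G i y \<noteq> 0} \<noteq> {}}"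
      using T(1,2) by blast
    have xT: "x \<in> T \<inter> \<Omega>" using x T by simp
    show "((\<lambda>i. (G i x)\<^sup>2) has_sum f x) K"
    proof (rule has_sum_finite_neutralI)
      show "finite ((J \<times> Basis) \<inter> K)" using T(3) by simp
      show "(J \<times> Basis) \<inter> K \<subseteq> K" by simp
      show "(G i x)\<^sup>2 = 0" if "i \<in> K - (J \<times> Basis) \<inter> K" for i
        using that K G0[OF xT] by auto
      have "f x = (\<Sum>j\<in>J. (e j x)\<^sup>2) * f x"
        using one[OF xT] by simp
      also have "\<dots> = (\<Sum>j\<in>J. (e j x)\<^sup>2 * f x)"
        by (rule sum_distrib_right)
      also have "\<dots> = (\<Sum>j\<in>J. \<Sum>b\<in>Basis. (G (j, b) x)\<^sup>2)"
      proof (rule sum.cong[OF refl])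
        fix j
        show "(e j x)\<^sup>2 * f x = (\<Sum>b\<in>Basis. (G (j, b) x)\<^sup>2)"
        proof (cases "x \<in> V j")
          case True
          then have "f x = (\<Sum>b\<in>Basis. (F j b x)\<^sup>2)"
            using sos[of j] by (simp add: local_sos_def)
          then show ?thesis
            using True by (simp add: G_def power_mult_distrib sum_distrib_left)
        next
          case False
          then have "e j x = 0" using supp[of x j] x by blast
          then show ?thesis using False by (simp add: G_def)
        qed
      qed
      also have "\<dots> = (\<Sum>i\<in>J \<times> Basis. (G i x)\<^sup>2)"
        by (simp add: sum.cartesian_product)
      also have "\<dots> = (\<Sum>i\<in>(J \<times> Basis) \<inter> K. (G i x)\<^sup>2)"
      proof (rule sum.mono_neutral_right)
        show "\<forall>i\<in>J \<times> Basis - (J \<times> Basis) \<inter> K. (G i x)\<^sup>2 = 0"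
        proof
          fix i assume "i \<in> J \<times> Basis - (J \<times> Basis) \<inter> K"
          then obtain j b where "i = (j, b)" "b \<in> Basis" "(j, b) \<notin> K" by blast
          then show "(G i x)\<^sup>2 = 0"
            using outside[of b x j] by (simp add: G_def)
        qed
      qed (use T(3) in auto)
      finally show "f x = (\<Sum>i\<in>(J \<times> Basis) \<inter> K. (G i x)\<^sup>2)" .
    qed
  qed
qed

text \<open>The gradient \<open>g\<close> has an injective derivative at \<open>x0\<close>, so it is
  non-zero at nearby points other than \<open>x0\<close>, whereas it vanishes at every zero of
  \<open>f\<close>.\<close>

lemma positive_definite_zero_isolated:
  fixes f :: "'a::euclidean_space \<Rightarrow> real"
  assumes \<Omega>: "open \<Omega>" and C: "Ck_on (Suc (Suc m)) \<Omega> f" and nonneg: "\<And>x. x \<in> \<Omega> \<Longrightarrow> f x \<ge> 0"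
    and x0: "x0 \<in> \<Omega>" "f x0 = 0" and pd: "positive_definite_hessian f x0"
  shows "\<exists>d>0. \<forall>y\<in>{x \<in> \<Omega>. f x = 0}. dist x0 y < d \<longrightarrow> y = x0"
proof -
  define g where "g y = (\<Sum>b\<in>Basis. frechet_derivative f (at y) b *\<^sub>R b)" for y
  have der: "(g has_derivative hessian f x0) (at x0)"
    unfolding g_def hessian_def
    by (intro has_derivative_sum has_derivative_scaleR_left second_deriv_has_derivative[OF C _ x0(1)])
  have g0: "g y = 0" if "y \<in> \<Omega>" "f y = 0" for y
    using nonneg_zero_imp_critical[OF \<Omega> C nonneg that] by (simp add: g_def)
  have lin: "linear (hessian f x0)"
    using linear_hessian[OF C x0(1)] .
  have "v = 0" if "hessian f x0 v = 0" for v
    using pd that unfolding positive_definite_hessian_def by force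
  then have "inj (hessian f x0)"
    using lin linear_injective_0 by blast
  then obtain B where B: "B > 0" "\<And>v. B * norm v \<le> norm (hessian f x0 v)"
    using linear_inj_bounded_below_pos[OF lin] by blast
  have "B / 2 > 0" using B(1) by simp
  then obtain d where d: "d > 0"
    "\<And>y. norm (y - x0) < d \<Longrightarrow> norm (g y - g x0 - hessian f x0 (y - x0)) \<le> B / 2 * norm (y - x0)"
    using der unfolding has_derivative_at_alt by blast
  have "y = x0" if y: "y \<in> \<Omega>" "f y = 0" "dist x0 y < d" for y
  proof -
    have "norm (hessian f x0 (y - x0)) \<le> B / 2 * norm (y - x0)"
      using d(2)[of y] y g0[OF y(1,2)] g0[OF x0] by (simp add: dist_norm norm_minus_commute)
    then have "B * norm (y - x0) \<le> B / 2 * norm (y - x0)"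
      using B(2)[of "y - x0"] by linarith
    then have "norm (y - x0) \<le> 0"
      using B(1) by (simp add: field_simps)
    then show ?thesis by simp
  qed
  then show ?thesis using d(1) by blast
qed

theorem theorem2p8:
  fixes f :: "'a::euclidean_space \<Rightarrow> real" and \<Omega> :: "'a set" and p :: nat
  assumes "p \<ge> 2" and "open \<Omega>"
    and "Ck_on p \<Omega> f"
    and "\<forall>x\<in>\<Omega>. f x \<ge> 0"
    and "\<forall>x0\<in>{x\<in>\<Omega>. f x = 0}. NHC f {x\<in>\<Omega>. f x = 0} x0"
  shows "(\<exists>I fs. SOS_decomp (p - 2) \<Omega> f I fs)
    \<and> ((\<forall>x0\<in>{x\<in>\<Omega>. f x = 0}. positive_definite_hessian f x0) \<longrightarrow>
         discrete {x\<in>\<Omega>. f x = 0} \<and>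
         (\<exists>I fs. SOS_decomp (p - 2) \<Omega> f I fs \<and> finite I \<and> card I \<le> DIM('a) + 1))
    \<and> (compact {x\<in>\<Omega>. f x = 0} \<longrightarrow>
         (\<exists>I fs. SOS_decomp (p - 2) \<Omega> f I fs \<and> finite I))"
proof -
  define m where "m = p - 2"
  define Z where "Z = {x\<in>\<Omega>. f x = 0}"
  define P where "P = {x\<in>\<Omega>. f x > 0}"
  have p: "p = Suc (Suc m)" using assms(1) by (simp add: m_def)
  have C: "Ck_on (Suc (Suc m)) \<Omega> f" using assms(3) p by simp
  have nonneg: "\<And>x. x \<in> \<Omega> \<Longrightarrow> f x \<ge> 0" using assms(4) by blast
  have Cm: "Ck_on m \<Omega> f" using Ck_on_le[OF C, of m] by simp
  obtain b0 :: 'a where b0: "b0 \<in> Basis" using nonempty_Basis by blast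
  have "P = \<Omega> \<inter> f -` {0<..}" by (auto simp: P_def)
  then have P: "open P" "P \<subseteq> \<Omega>"
    using continuous_open_preimage[OF Ck_on_imp_continuous_on[OF C] assms(2) open_greaterThan[of 0]] by auto
  have \<Omega>_eq: "\<Omega> = P \<union> Z" using nonneg by (force simp: P_def Z_def)
  define FP where "FP = (\<lambda>b x. if b = b0 then sqrt (f x) else 0)"
  have sosP: "local_sos m P f FP"
    unfolding FP_def
    by (rule local_sos_sqrt[OF P(1) Ck_on_subset[OF Cm P(2)] _ b0]) (simp add: P_def)
  have chart: "\<exists>r>0. ball x r \<subseteq> \<Omega> \<and> (\<exists>F. local_sos m (ball x r) f F)" if x: "x \<in> \<Omega>" for x
  proof (cases "x \<in> Z")
    case True
    then show ?thesis
      using local_sos_at_zero[OF assms(2) C nonneg, of x] assms(5) by (simp add: Z_def)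
  next
    case False
    then have "x \<in> P" using x \<Omega>_eq by blast
    then obtain r where r: "r > 0" "ball x r \<subseteq> P" using P(1) openE by blast
    then have "local_sos m (ball x r) f FP"
      using sosP Ck_on_subset[OF _ r(2)] by (auto simp: local_sos_def)
    then show ?thesis using r P(2) by blast
  qed
  then obtain r F where r: "\<And>x. x \<in> \<Omega> \<Longrightarrow> r x > 0" "\<And>x. x \<in> \<Omega> \<Longrightarrow> ball x (r x) \<subseteq> \<Omega>"
    and F: "\<And>x. x \<in> \<Omega> \<Longrightarrow> local_sos m (ball x (r x)) f (F x)"
    by metis
  \<comment> \<open>Charts are indexed by all naturals; this fills the indices beyond a finite
    family.\<close>
  have empty_sos: "local_sos m {} f G" for G
    unfolding local_sos_def using Ck_on_cong[OF open_empty _ Ck_on_const] by blast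

  have general: "\<exists>I fs. SOS_decomp m \<Omega> f I fs"
  proof (cases "\<Omega> = {}")
    case True
    then have "SOS_decomp m \<Omega> f {} (\<lambda>_ _. 0)" by (simp add: SOS_decomp_def)
    then show ?thesis by blast
  next
    case False
    have "\<forall>x\<in>\<Omega>. r x > 0" using r(1) by blast
    then obtain c :: "nat \<Rightarrow> 'a" where c: "\<And>k. c k \<in> \<Omega>" "\<Omega> \<subseteq> (\<Union>k. ball (c k) (r (c k)))"
      using countable_ball_cover[OF False] by blast
    have "\<exists>I fs. SOS_decomp m \<Omega> f I fs \<and> (finite (UNIV \<times> Basis :: (nat \<times> 'a) set) \<longrightarrow> finite I) \<and>
        card I = card (UNIV \<times> Basis :: (nat \<times> 'a) set)"
      by (rule SOS_decomp_from_charts[OF assms(2), of "\<lambda>k. ball (c k) (r (c k))" _ _ "\<lambda>k. F (c k)"])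
        (use c r F in auto)
    then show ?thesis by blast
  qed

  have strict: "discrete Z \<and> (\<exists>I fs. SOS_decomp m \<Omega> f I fs \<and> finite I \<and> card I \<le> DIM('a) + 1)"
    if pd: "\<forall>x0\<in>Z. positive_definite_hessian f x0"
  proof -
    have iso: "\<exists>d>0. \<forall>y\<in>Z. dist z y < d \<longrightarrow> y = z" if "z \<in> Z" for z
      using positive_definite_zero_isolated[OF assms(2) C nonneg, of z] pd that by (simp add: Z_def)
    have "discrete Z"
      using iso by (intro discreteI) (auto simp: isolated_in_dist_Ex_iff)
    obtain d where d: "\<And>z. z \<in> Z \<Longrightarrow> d z > 0"
      "\<And>z y. z \<in> Z \<Longrightarrow> y \<in> Z \<Longrightarrow> dist z y < d z \<Longrightarrow> y = z"
      using iso by metis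
    \<comment> \<open>Half the isolation radius makes the balls pairwise disjoint, so their union is
      a single chart even for infinitely many zeros.\<close>
    define \<rho> where "\<rho> z = min (r z) (d z / 2)" for z
    have Z\<Omega>: "Z \<subseteq> \<Omega>" by (auto simp: Z_def)
    have \<rho>: "\<rho> z > 0" "ball z (\<rho> z) \<subseteq> ball z (r z)" if "z \<in> Z" for z
      using that d(1)[OF that] r(1)[of z] Z\<Omega> by (auto simp: \<rho>_def)
    have disj: "z = z'" if z: "z \<in> Z" "z' \<in> Z" "x \<in> ball z (\<rho> z)" "x \<in> ball z' (\<rho> z')" for z z' x
    proof -
      have "dist z z' < d z / 2 + d z' / 2"
        using dist_triangle_less_add[of z x "d z / 2" z' "d z' / 2"] z by (simp add: \<rho>_def dist_commute)
      then have "dist z z' < d z \<or> dist z' z < d z'"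
        by (simp add: dist_commute) linarith
      then show ?thesis using d(2) z by blast
    qed
    define V where "V j = (if j = 0 then \<Union>z\<in>Z. ball z (\<rho> z) else if j = 1 then P else {})" for j :: nat
    \<comment> \<open>By disjointness the centre is unique and constant on each ball, so the local
      functions combine without losing smoothness.\<close>
    define ctr where "ctr x = (SOME z. z \<in> Z \<and> x \<in> ball z (\<rho> z))" for x
    have ctr: "ctr x = z" if "z \<in> Z" "x \<in> ball z (\<rho> z)" for x z
      unfolding ctr_def using that disj by (intro some_equality) blast+
    define G where "G j = (if j = 0 then (\<lambda>b x. F (ctr x) b x) else FP)" for j :: nat
    have sosV0: "local_sos m (V 0) f (G 0)"
      unfolding local_sos_def
    proof (intro conjI ballI)
      fix b :: 'a assume b: "b \<in> Basis"
      show "Ck_on m (V 0) (G 0 b)"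
      proof (rule Ck_on_local)
        show "open (V 0)" by (auto simp: V_def)
        fix x assume "x \<in> V 0"
        then obtain z where z: "z \<in> Z" "x \<in> ball z (\<rho> z)" by (auto simp: V_def)
        have "Ck_on m (ball z (\<rho> z)) (F z b)"
          using F[of z] z(1) Z\<Omega> b Ck_on_subset[OF _ \<rho>(2)[OF z(1)]] by (auto simp: local_sos_def)
        then have "Ck_on m (ball z (\<rho> z)) (G 0 b)"
          by (rule Ck_on_cong[OF open_ball, rotated]) (simp only: G_def ctr[OF z(1)] if_True refl)
        then have "Ck_on m (ball z (\<rho> z) \<inter> V 0) (G 0 b)"
          by (rule Ck_on_subset) simp
        then show "\<exists>T. open T \<and> x \<in> T \<and> Ck_on m (T \<inter> V 0) (G 0 b)"
          using z(2) open_ball by blast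
      qed
    next
      fix x assume "x \<in> V 0"
      then obtain z where z: "z \<in> Z" "x \<in> ball z (\<rho> z)" by (auto simp: V_def)
      then have "f x = (\<Sum>b\<in>Basis. (F z b x)\<^sup>2)"
        using F[of z] Z\<Omega> \<rho>(2)[OF z(1)] unfolding local_sos_def by blast
      then show "f x = (\<Sum>b\<in>Basis. (G 0 b x)\<^sup>2)"
        using ctr[OF z] by (simp add: G_def)
    qed
    \<comment> \<open>Chart 0 contributes \<open>DIM('a)\<close> functions and chart 1, where
      \<open>f\<close> is positive, only the root stored at \<open>b0\<close>.\<close>
    have "\<exists>I fs. SOS_decomp m \<Omega> f I fs \<and> (finite (insert (1::nat, b0) ({0} \<times> Basis)) \<longrightarrow> finite I) \<and>
        card I = card (insert (1::nat, b0) ({0} \<times> Basis))"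
    proof (rule SOS_decomp_from_charts[OF assms(2)])
      show "open (V j)" for j using P by (auto simp: V_def)
      have "ball z (\<rho> z) \<subseteq> \<Omega>" if "z \<in> Z" for z
        using \<rho>(2)[OF that] r(2)[of z] Z\<Omega> that by blast
      then show "V j \<subseteq> \<Omega>" for j
        using P(2) by (simp add: V_def UN_subset_iff)
      have "z \<in> V 0" if "z \<in> Z" for z
        using \<rho>(1)[OF that] that by (auto simp: V_def intro!: bexI[of _ z])
      moreover have "P = V 1" by (simp add: V_def)
      ultimately show "\<Omega> \<subseteq> (\<Union>j. V j)" using \<Omega>_eq by blast
      show "local_sos m (V j) f (G j)" for j
      proof -
        consider "j = 0" | "j = 1" | "j \<noteq> 0" "j \<noteq> 1" by blast
        then show ?thesis
        proof cases
          case 1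
          then show ?thesis using sosV0 by simp
        next
          case 2
          then show ?thesis using sosP by (simp add: V_def G_def)
        next
          case 3
          then show ?thesis using empty_sos by (simp add: V_def)
        qed
      qed
      show "insert (1, b0) ({0} \<times> Basis) \<subseteq> UNIV \<times> Basis" using b0 by auto
      show "G j b x = 0" if "b \<in> Basis" "x \<in> V j" "(j, b) \<notin> insert (1, b0) ({0} \<times> Basis)" for j b x
        using that by (auto simp: G_def V_def FP_def split: if_splits)
    qed
    moreover have "card (insert (1::nat, b0) ({0} \<times> Basis)) = DIM('a) + 1"
      by (subst card_insert_disjoint) (auto simp: card_cartesian_product_singleton)
    ultimately have "\<exists>I fs. SOS_decomp m \<Omega> f I fs \<and> finite I \<and> card I \<le> DIM('a) + 1"
      by (metis finite_Basis finite_SigmaI finite_insert finite.emptyI order_refl)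
    then show ?thesis
      using \<open>discrete Z\<close> by blast
  qed

  have compact: "\<exists>I fs. SOS_decomp m \<Omega> f I fs \<and> finite I" if "compact Z"
  proof -
    have Z\<Omega>: "Z \<subseteq> \<Omega>" by (auto simp: Z_def)
    have "Z \<subseteq> (\<Union>z\<in>Z. ball z (r z))" using r(1) Z\<Omega> by force
    then obtain D where D: "D \<subseteq> Z" "finite D" "Z \<subseteq> (\<Union>z\<in>D. ball z (r z))"
      using compactE_image[OF \<open>compact Z\<close>, of Z "\<lambda>z. ball z (r z)"] by blast
    define n where "n = card D"
    obtain h where h: "bij_betw h {0..<n} D"
      using ex_bij_betw_nat_finite[OF D(2)] n_def by blast
    have h\<Omega>: "h j \<in> \<Omega>" if "j < n" for j
    proof -
      have "h j \<in> D" using bij_betwE[OF h] that by simp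
      then show ?thesis using D(1) Z\<Omega> by blast
    qed
    \<comment> \<open>Finitely many balls cover the compact zero set; index \<open>n\<close> holds
      the region where \<open>f\<close> is positive.\<close>
    define V where "V j = (if j < n then ball (h j) (r (h j)) else if j = n then P else {})" for j
    define G where "G j = (if j < n then F (h j) else FP)" for j
    have "\<exists>I fs. SOS_decomp m \<Omega> f I fs \<and> (finite ({..n} \<times> (Basis::'a set)) \<longrightarrow> finite I) \<and>
        card I = card ({..n} \<times> (Basis::'a set))"
    proof (rule SOS_decomp_from_charts[OF assms(2)])
      show "open (V j)" for j using P by (auto simp: V_def)
      show "V j \<subseteq> \<Omega>" for j using P(2) r(2) h\<Omega> by (simp add: V_def)
      show "\<Omega> \<subseteq> (\<Union>j. V j)"
      proof
        fix x assume "x \<in> \<Omega>"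
        then consider "x \<in> P" | "x \<in> Z" using \<Omega>_eq by blast
        then show "x \<in> (\<Union>j. V j)"
        proof cases
          case 1
          then have "x \<in> V n" by (simp add: V_def)
          then show ?thesis by blast
        next
          case 2
          then obtain z where z: "z \<in> D" "x \<in> ball z (r z)" using D(3) by blast
          then obtain j where "j < n" "h j = z"
            using bij_betw_imp_surj_on[OF h] by (metis atLeastLessThan_iff imageE)
          then have "x \<in> V j" using z by (simp add: V_def)
          then show ?thesis by blast
        qed
      qed
      show "local_sos m (V j) f (G j)" for j
      proof -
        consider "j < n" | "j = n" | "j > n" by linarith
        then show ?thesis
        proof cases
          case 1
          then show ?thesis using F[OF h\<Omega>[OF 1]] by (simp add: V_def G_def)
        next
          case 2
          then show ?thesis using sosP by (simp add: V_def G_def)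
        next
          case 3
          then show ?thesis using empty_sos by (simp add: V_def)
        qed
      qed
      show "G j b x = 0" if "b \<in> Basis" "x \<in> V j" "(j, b) \<notin> {..n} \<times> Basis" for j b x
        using that by (auto simp: V_def split: if_splits)
    qed auto
    then show ?thesis by auto
  qed

  show ?thesis
    using general strict compact unfolding Z_def m_def by blast
qed

end
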